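(* With the notation of the context and $h\le h_0$, the block Gauss-Seidel generalized eigenvalue problem $$\begin{bmatrix} H_T & M_1 \\ M_2 & H_P \end{bmatrix}\begin{bmatrix} T \\ P \end{bmatrix}=\lambda\begin{bmatrix} H_T & 0 \\ M_2 & H_P \end{bmatrix}\begin{bmatrix} T \\ P \end{bmatrix},\qquad \begin{bmatrix} T \\ P \end{bmatrix}\neq0,$$ has an eigenvalue $1$ with multiplicity $\dim\mathcal{V}_h$, and another $\dim\mathcal{V}_h$ eigenvalues (counted with multiplicity) contained in the ball of radius $C_TC_P(\gamma-1)\left|1-\tfrac{\Lambda}{\mathcal{M}}\right|$ around $1$.
   Context: $\Omega\subset\mathbb{R}^d$ ($d=2,3$) is a bounded domain with $\partial\Omega=\Gamma_a\cup\Gamma_w$; $\mathcal{V}_h\subset H^1(\Omega)$ is the complex-valued space of continuous piecewise polynomials of some fixed degree $k\ge 1$ on a conforming quasiuniform triangulation of mesh size $h$, with basis $\{\psi_\imath\}_{\imath=1}^{\dim\mathcal{V}_h}$. $(f,g)=\int_\Omega f\overline g\,dx$, $\langle f,g\rangle_{\Gamma_a}=\int_{\Gamma_a}f\overline g\,ds$, $\|\cdot\|$ is the $L^2(\Omega)$ norm. Parameters: $\gamma>1$, $\mathcal{M}>0$, $\Lambda>0$, with $\Lambda\ne\mathcal{M}$. Matrices: mass matrix $M_{\imath\jmath}=(\psi_\jmath,\psi_\imath)$, stiffness matrix $K_{\imath\jmath}=(\nabla\psi_\jmath,\nabla\psi_\imath)$, $K^\gamma_{\imath\jmath}=(\nabla\psi_\jmath,\nabla\psi_\imath)-i\sqrt\gamma\langle\psi_\jmath,\psi_\imath\rangle_{\Gamma_a}$,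 $$H_T=\mathcal{M}K-iM,\quad H_P=(1-i\gamma\Lambda)K^\gamma-\Big[\gamma\big(1-\tfrac{\Lambda}{\mathcal{M}}\big)-\tfrac{\Lambda}{\mathcal{M}}\Big]M,\quad M_1=i\tfrac{\gamma-1}{\gamma}M,\quad M_2=\gamma\big(1-\tfrac{\Lambda}{\mathcal{M}}\big)M.$$ $\mathcal{A}_{T,h},\mathcal{A}_{P,h}:\mathcal{V}_h\to\mathcal{V}_h'$ are the operators associated with the sesquilinear forms of $H_T$ and $H_P$. Standing assumption: for $h\le h_0$ these operators are invertible, and $C_T,C_P$ are constants independent of $h$ with $\|\mathcal{A}_{T,h}^{-1}\|\le C_T$ and $\|\mathcal{A}_{P,h}^{-1}\|\le C_P$, where the operator norms are taken with respect to the $L^2$ norm on $\mathcal{V}_h$ and the corresponding dual norm on $\mathcal{V}_h'$; equivalently $\|H_T^{-1}M\|_M\le C_T$ and $\|H_P^{-1}M\|_M\le C_P$, where $\|\cdot\|_M$ is the matrix norm induced by the vector norm $\|\mathrm{u}\|_M=(\mathrm{u}^*M\mathrm{u})^{1/2}$. *)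

theory Defs
  imports "HOL-Analysis.Analysis" "Jordan_Normal_Form.Char_Poly"
begin

section \<open>Surface measure\<close>

text \<open>
  The measure \<open>ds\<close> on boundaries is the \<open>(d-1)\<close>-dimensional Hausdorff measure, normalised so that
  it agrees with the \<open>(d-1)\<close>-dimensional Lebesgue measure on hyperplanes.
  Sets in a cover must be bounded because \<^const>\<open>diameter\<close> is unspecified on unbounded sets; for
  \<open>d \<ge> 2\<close> empty sets in a cover contribute \<open>0\<close>.
\<close>

definition surface_content :: "real \<Rightarrow> 'a::euclidean_space set \<Rightarrow> ennreal" where
  "surface_content \<delta> A =
     (INF C\<in>{C :: nat \<Rightarrow> 'a set. A \<subseteq> (\<Union>i. C i) \<and> (\<forall>i. bounded (C i) \<and> diameter (C i) \<le> \<delta>)}.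
        \<Sum>i. ennreal (unit_ball_vol (real (DIM('a) - 1)) * (diameter (C i) / 2) ^ (DIM('a) - 1)))"

definition surface_outer_measure :: "'a::euclidean_space set \<Rightarrow> ennreal" where
  "surface_outer_measure A = (SUP \<delta>\<in>{0<..}. surface_content \<delta> A)"

definition surface_measure :: "'a::euclidean_space measure" where
  "surface_measure = measure_of UNIV (sets borel) surface_outer_measure"


text \<open>
  \<^const>\<open>measure_of\<close> yields the zero measure when the given set function is not a measure on the
  \<open>\<sigma>\<close>-algebra; \<open>emeasure_surface_measure\<close> below (Caratheodory's criterion) rules this out.
\<close>

lemma surface_content_mono:
  "A \<subseteq> B \<Longrightarrow> \<delta>' \<le> \<delta> \<Longrightarrow> surface_content \<delta> A \<le> surface_content \<delta>' B"
  unfolding surface_content_def by (rule INF_superset_mono) (auto intro: order_trans)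

lemma surface_content_empty:
  assumes "2 \<le> DIM('a::euclidean_space)" "0 < \<delta>"
  shows "surface_content \<delta> ({} :: 'a set) = 0"
proof -
  have "surface_content \<delta> ({} :: 'a set) \<le>
     (\<Sum>i::nat. ennreal (unit_ball_vol (real (DIM('a) - 1)) * (diameter ({}::'a set) / 2) ^ (DIM('a) - 1)))"
    unfolding surface_content_def by (rule INF_lower2[where i = "\<lambda>_. {}"]) (use assms in auto)
  also have "\<dots> = 0" using assms by (simp add: power_0_left)
  finally show ?thesis by simp
qed

lemma surface_content_subadditive:
  "surface_content \<delta> (\<Union>i. A i) \<le> (\<Sum>i. surface_content \<delta> (A i :: 'a::euclidean_space set))"
proof (rule ennreal_le_epsilon)
  define w where "w S = ennreal (unit_ball_vol (real (DIM('a) - 1)) * (diameter S / 2) ^ (DIM('a) - 1))"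
    for S :: "'a set"
  fix e :: real assume fin: "(\<Sum>i. surface_content \<delta> (A i)) < Orderings.top" and e: "0 < e"
  have fin': "surface_content \<delta> (A i) \<noteq> Orderings.top" for i
    using ennreal_suminf_lessD[OF fin, of i] by simp
  have "\<exists>C. A i \<subseteq> (\<Union>j. C j) \<and> (\<forall>j. bounded (C j) \<and> diameter (C j) \<le> \<delta>) \<and>
          (\<Sum>j. w (C j)) \<le> surface_content \<delta> (A i) + ennreal (e * (1/2) ^ Suc i)" for i
  proof -
    have "surface_content \<delta> (A i) < surface_content \<delta> (A i) + ennreal (e * (1/2) ^ Suc i)"
    proof -
      have "0 < ennreal (e * (1/2) ^ Suc i)" using e by (simp add: ennreal_less_zero_iff)
      then show ?thesis
        using fin'[of i] ennreal_add_left_cancel_less[of "surface_content \<delta> (A i)" 0] by simp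
    qed
    then show ?thesis
      unfolding surface_content_def INF_less_iff w_def by (auto intro: less_imp_le)
  qed
  then obtain C where C: "\<And>i. A i \<subseteq> (\<Union>j. C i j)" "\<And>i j. bounded (C i j)"
     "\<And>i j. diameter (C i j) \<le> \<delta>"
     "\<And>i. (\<Sum>j. w (C i j)) \<le> surface_content \<delta> (A i) + ennreal (e * (1/2) ^ Suc i)"
    by metis
  define D where "D n = case_prod C (prod_decode n)" for n
  have "surface_content \<delta> (\<Union>i. A i) \<le> (\<Sum>n. w (D n))"
    unfolding surface_content_def w_def
  proof (rule INF_lower, intro CollectI conjI allI)
    show "(\<Union>i. A i) \<subseteq> (\<Union>n. D n)"
    proof
      fix x assume "x \<in> (\<Union>i. A i)"
      then obtain i j where "x \<in> C i j" using C(1) by blast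
      then have "x \<in> D (prod_encode (i, j))" by (simp add: D_def)
      then show "x \<in> (\<Union>n. D n)" by blast
    qed
  qed (auto simp: D_def C(2,3) split: prod.split)
  also have "\<dots> = (\<Sum>i. \<Sum>j. w (C i j))"
    using suminf_ennreal_2dimen[of "\<lambda>i. \<Sum>j. w (C i j)" "\<lambda>(i, j). w (C i j)"]
    by (simp add: D_def comp_def case_prod_unfold)
  also have "\<dots> \<le> (\<Sum>i. surface_content \<delta> (A i) + ennreal (e * (1/2) ^ Suc i))"
    by (intro suminf_le C(4)) auto
  also have "\<dots> = (\<Sum>i. surface_content \<delta> (A i)) + (\<Sum>i. ennreal (e * (1/2) ^ Suc i))"
    by (intro suminf_add[symmetric]) auto
  also have "(\<Sum>i. ennreal (e * (1/2) ^ Suc i)) = ennreal e"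
    using sums_mult[OF power_half_series, of e] e
    by (subst suminf_ennreal_eq) auto
  finally show "surface_content \<delta> (\<Union>i. A i) \<le> (\<Sum>i. surface_content \<delta> (A i)) + ennreal e" .
qed

lemma surface_outer_measure_mono:
  "A \<subseteq> B \<Longrightarrow> surface_outer_measure A \<le> surface_outer_measure B"
  unfolding surface_outer_measure_def by (intro SUP_mono) (auto intro!: surface_content_mono)

lemma surface_outer_measure_subadditive:
  "surface_outer_measure (\<Union>i. A i) \<le> (\<Sum>i. surface_outer_measure (A i))"
  unfolding surface_outer_measure_def[of "\<Union>i. A i"]
proof (rule SUP_least)
  fix \<delta> :: real assume \<delta>: "\<delta> \<in> {0<..}"
  have "(\<Sum>i. surface_content \<delta> (A i)) \<le> (\<Sum>i. surface_outer_measure (A i))"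
    using \<delta> unfolding surface_outer_measure_def by (intro suminf_le SUP_upper) auto
  with surface_content_subadditive[of \<delta> A]
  show "surface_content \<delta> (\<Union>i. A i) \<le> (\<Sum>i. surface_outer_measure (A i))" by (rule order_trans)
qed

lemma surface_outer_measure_space:
  assumes "2 \<le> DIM('a::euclidean_space)"
  shows "outer_measure_space UNIV (surface_outer_measure :: 'a set \<Rightarrow> ennreal)"
  using assms surface_content_empty[where 'a = 'a]
  by (auto simp: outer_measure_space_def positive_def increasing_def countably_subadditive_def
      surface_outer_measure_mono surface_outer_measure_subadditive)
     (auto simp: surface_outer_measure_def intro!: SUP_eq_const)

lemma surface_outer_measure_Un_le:
  assumes "2 \<le> DIM('a::euclidean_space)"
  shows "surface_outer_measure (A \<union> B :: 'a set) \<le> surface_outer_measure A + surface_outer_measure B"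
proof -
  have "subadditive UNIV (surface_outer_measure :: 'a set \<Rightarrow> ennreal)"
    using surface_outer_measure_space[OF assms]
      ring_of_sets.countably_subadditive_subadditive[OF sigma_algebra.axioms(1)[THEN Sigma_Algebra.algebra.axioms(1)],
        OF sigma_algebra_Pow[of "UNIV :: 'a set"]]
    by (simp add: outer_measure_space_def)
  from subadditiveD[OF this, of A "B - A"]
  have "surface_outer_measure (A \<union> B) \<le> surface_outer_measure A + surface_outer_measure (B - A)" by simp
  also have "\<dots> \<le> surface_outer_measure A + surface_outer_measure B"
    by (intro add_left_mono surface_outer_measure_mono) auto
  finally show ?thesis .
qed

lemma surface_outer_measure_separated:
  fixes A B :: "'a::euclidean_space set"
  assumes d: "2 \<le> DIM('a)" and r: "0 < r" and sep: "\<And>x y. x \<in> A \<Longrightarrow> y \<in> B \<Longrightarrow> r \<le> dist x y"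
  shows "surface_outer_measure A + surface_outer_measure B \<le> surface_outer_measure (A \<union> B)"
proof -
  define w where "w S = ennreal (unit_ball_vol (real (DIM('a) - 1)) * (diameter S / 2) ^ (DIM('a) - 1))"
    for S :: "'a set"
  have w0: "w {} = 0" using d by (simp add: w_def power_0_left)
  have *: "surface_content \<delta> A + surface_content \<delta> B \<le> surface_content \<delta> (A \<union> B)"
    if \<delta>: "0 < \<delta>" "\<delta> < r" for \<delta>
    unfolding surface_content_def[of _ "A \<union> B"] w_def[symmetric]
  proof (rule INF_greatest)
    fix C :: "nat \<Rightarrow> 'a set"
    assume "C \<in> {C. A \<union> B \<subseteq> (\<Union>i. C i) \<and> (\<forall>i. bounded (C i) \<and> diameter (C i) \<le> \<delta>)}"
    then have C: "A \<union> B \<subseteq> (\<Union>i. C i)" "\<And>i. bounded (C i)" "\<And>i. diameter (C i) \<le> \<delta>" by auto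
    define D where "D X i = (if C i \<inter> X = {} then {} else C i)" for X i
    have le: "surface_content \<delta> X \<le> (\<Sum>i. w (D X i))" if "X \<subseteq> (\<Union>i. C i)" for X
      unfolding surface_content_def w_def
    proof (rule INF_lower, intro CollectI conjI allI)
      show "X \<subseteq> (\<Union>i. D X i)"
      proof
        fix x assume x: "x \<in> X"
        then obtain i where "x \<in> C i" using \<open>X \<subseteq> (\<Union>i. C i)\<close> by blast
        with x have "x \<in> D X i" by (auto simp: D_def)
        then show "x \<in> (\<Union>i. D X i)" by blast
      qed
    qed (use C \<delta> in \<open>auto simp: D_def\<close>)
    have disj: "C i \<inter> A = {} \<or> C i \<inter> B = {}" for i
    proof (rule ccontr)
      assume "\<not> ?thesis"
      then obtain x y where xy: "x \<in> C i" "x \<in> A" "y \<in> C i" "y \<in> B" by blast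
      with diameter_bounded_bound[OF C(2), of x i y] C(3)[of i] sep[of x y] \<delta> show False by simp
    qed
    have "surface_content \<delta> A + surface_content \<delta> B \<le> (\<Sum>i. w (D A i)) + (\<Sum>i. w (D B i))"
      using C(1) by (intro add_mono le) auto
    also have "\<dots> = (\<Sum>i. w (D A i) + w (D B i))" by (intro suminf_add) auto
    also have "\<dots> \<le> (\<Sum>i. w (C i))"
      by (intro suminf_le) (use disj in \<open>auto simp: D_def w0\<close>)
    finally show "surface_content \<delta> A + surface_content \<delta> B \<le> (\<Sum>i. w (C i))" .
  qed
  have **: "surface_content \<delta>1 A + surface_content \<delta>2 B \<le> surface_outer_measure (A \<union> B)"
    if "0 < \<delta>1" "0 < \<delta>2" for \<delta>1 \<delta>2
  proof -
    define \<delta> where "\<delta> = min (min \<delta>1 \<delta>2) (r / 2)"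
    have \<delta>: "0 < \<delta>" "\<delta> < r" "\<delta> \<le> \<delta>1" "\<delta> \<le> \<delta>2" using that r by (auto simp: \<delta>_def)
    have "surface_content \<delta>1 A + surface_content \<delta>2 B \<le> surface_content \<delta> A + surface_content \<delta> B"
      by (intro add_mono surface_content_mono \<delta>) auto
    also have "\<dots> \<le> surface_content \<delta> (A \<union> B)" using * \<delta> by blast
    also have "\<dots> \<le> surface_outer_measure (A \<union> B)"
      unfolding surface_outer_measure_def using \<delta> by (intro SUP_upper) auto
    finally show ?thesis .
  qed
  have ne: "{0::real<..} \<noteq> {}" by (auto intro: exI[of _ 1])
  have "surface_content \<delta>1 A + surface_outer_measure B \<le> surface_outer_measure (A \<union> B)"
    if "0 < \<delta>1" for \<delta>1
    unfolding surface_outer_measure_def[of B] ennreal_SUP_add_right[OF ne]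
    using that by (intro SUP_least **) auto
  then show ?thesis
    unfolding surface_outer_measure_def[of A] ennreal_SUP_add_left[OF ne, symmetric]
    by (intro SUP_least) auto
qed

lemma closed_in_lambda_system:
  fixes F :: "'a::euclidean_space set"
  assumes d: "2 \<le> DIM('a)" and F: "closed F"
  shows "F \<in> lambda_system UNIV UNIV surface_outer_measure"
proof (cases "F = {}")
  case True
  then show ?thesis using surface_outer_measure_space[OF d]
    by (auto simp: lambda_system_def outer_measure_space_def positive_def)
next
  case ne: False
  let ?H = "surface_outer_measure :: 'a set \<Rightarrow> ennreal"
  have H0: "?H {} = 0"
    using surface_outer_measure_space[OF d] by (auto simp: outer_measure_space_def positive_def)
  have main: "?H (A \<inter> F) + ?H (A - F) \<le> ?H A" for A
  proof (cases "?H A = Orderings.top")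
    case False
    define S where "S n = {x \<in> A. 1 / real (Suc n) \<le> infdist x F}" for n
    define R where "R n = {x \<in> A. 1 / real (n + 2) \<le> infdist x F \<and> infdist x F < 1 / real (n + 1)}" for n
    have S: "?H (A \<inter> F) + ?H (S n) \<le> ?H A" for n
    proof -
      have "?H (A \<inter> F) + ?H (S n) \<le> ?H ((A \<inter> F) \<union> S n)"
      proof (rule surface_outer_measure_separated[OF d, where r = "1 / real (Suc n)"])
        fix x y assume "x \<in> A \<inter> F" "y \<in> S n"
        then show "1 / real (Suc n) \<le> dist x y"
          using infdist_le[of x F y] by (auto simp: S_def dist_commute)
      qed simp
      also have "\<dots> \<le> ?H A" by (intro surface_outer_measure_mono) (auto simp: S_def)
      finally show ?thesis .
    qed
    have alt: "(\<Sum>k<m. ?H (R (2 * k + e))) \<le> ?H (\<Union>k<m. R (2 * k + e))" for m e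
    proof (induction m)
      case 0 then show ?case by (simp add: H0)
    next
      case (Suc m)
      let ?U = "\<Union>k<m. R (2 * k + e)"
      define r where "r = (if m = 0 then 1 else 1 / real (2 * m + e) - 1 / real (2 * m + e + 1))"
      have "(\<Sum>k<Suc m. ?H (R (2 * k + e))) \<le> ?H ?U + ?H (R (2 * m + e))"
        using Suc.IH by (simp add: add_right_mono)
      also have "\<dots> \<le> ?H (?U \<union> R (2 * m + e))"
      proof (rule surface_outer_measure_separated[OF d, where r = r])
        have "1 / real (2 * m + e + 1) < 1 / real (2 * m + e)" if "m \<noteq> 0"
          using that by (intro divide_strict_left_mono) auto
        then show "0 < r" by (auto simp: r_def)
        fix x y assume x: "x \<in> ?U" and y: "y \<in> R (2 * m + e)"
        from x obtain k where k: "k < m" "x \<in> R (2 * k + e)" by auto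
        have "1 / real (2 * m + e) \<le> 1 / real (2 * k + e + 2)"
          using k(1) by (intro divide_left_mono) auto
        also have "\<dots> \<le> infdist x F" using k(2) by (auto simp: R_def)
        finally have "1 / real (2 * m + e) \<le> infdist x F" .
        moreover have "infdist y F < 1 / real (2 * m + e + 1)" using y by (auto simp: R_def)
        moreover have "infdist x F \<le> infdist y F + dist x y" by (rule infdist_triangle)
        ultimately show "r \<le> dist x y" using k by (simp add: r_def)
      qed
      also have "?U \<union> R (2 * m + e) = (\<Union>k<Suc m. R (2 * k + e))" by (auto simp: lessThan_Suc)
      finally show ?case .
    qed
    have alt': "(\<Sum>k<m. ?H (R (2 * k + e))) \<le> ?H A" for m e
      by (rule order_trans[OF alt surface_outer_measure_mono]) (auto simp: R_def)
    have "(\<Sum>k<n. ?H (R k)) \<le> ?H A + ?H A" for n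
    proof -
      have "(\<Sum>k<n. ?H (R k)) \<le> (\<Sum>k<2*n. ?H (R k))" by (intro sum_mono2) auto
      also have "\<dots> = (\<Sum>k<n. ?H (R (2 * k + 0))) + (\<Sum>k<n. ?H (R (2 * k + 1)))"
        by (induction n) (auto simp: algebra_simps)
      also have "\<dots> \<le> ?H A + ?H A" by (intro add_mono alt')
      finally show ?thesis .
    qed
    then have "(\<Sum>k. ?H (R k)) \<le> ?H A + ?H A" by (intro suminf_le_const) auto
    moreover have "?H A + ?H A < Orderings.top" using False by (simp add: top.not_eq_extremum)
    ultimately have fin: "(\<Sum>k. ?H (R k)) < Orderings.top" by (rule le_less_trans)
    define g where "g k = enn2real (?H (R k))" for k
    have g: "?H (R k) = ennreal (g k)" for k
      using ennreal_suminf_lessD[OF fin, of k] by (simp add: g_def)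
    have g0: "0 \<le> g k" for k by (simp add: g_def)
    have sg: "summable g" using fin g g0 by (intro summable_suminf_not_top) auto
    show ?thesis
    proof (rule ennreal_le_epsilon)
      fix e :: real assume e: "0 < e"
      obtain n where "\<bar>\<Sum>i. g (i + n)\<bar> < e" using suminf_exist_split[OF e sg] by auto
      then have n: "(\<Sum>i. g (i + n)) \<le> e" by linarith
      have "A - F \<subseteq> S n \<union> (\<Union>i. R (i + n))"
      proof
        fix x assume x: "x \<in> A - F"
        then have pos: "0 < infdist x F" using infdist_pos_not_in_closed[OF F ne] by auto
        obtain m where m: "1 / real (Suc m) < infdist x F"
          using reals_Archimedean[OF pos] by (auto simp: inverse_eq_divide)
        define l where "l = (LEAST m. 1 / real (Suc m) \<le> infdist x F)"
        have l: "1 / real (Suc l) \<le> infdist x F"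
          unfolding l_def by (rule LeastI[of _ m]) (use m in simp)
        show "x \<in> S n \<union> (\<Union>i. R (i + n))"
        proof (cases "l \<le> n")
          case True
          have "1 / real (Suc n) \<le> 1 / real (Suc l)" using True by (intro divide_left_mono) auto
          with l x show ?thesis by (auto simp: S_def)
        next
          case False
          then obtain j where j: "l = Suc (j + n)"
            by (metis add.commute less_imp_Suc_add not_le)
          have "\<not> 1 / real (Suc (j + n)) \<le> infdist x F"
            by (rule not_less_Least) (use j in \<open>simp add: l_def\<close>)
          with l j x have "x \<in> R (j + n)" by (simp add: R_def add_ac)
          then show ?thesis by blast
        qed
      qed
      then have "?H (A - F) \<le> ?H (S n \<union> (\<Union>i. R (i + n)))" by (rule surface_outer_measure_mono)
      also have "\<dots> \<le> ?H (S n) + ?H (\<Union>i. R (i + n))" by (rule surface_outer_measure_Un_le[OF d])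
      also have "?H (\<Union>i. R (i + n)) \<le> (\<Sum>i. ?H (R (i + n)))" by (rule surface_outer_measure_subadditive)
      also have "\<dots> = ennreal (\<Sum>i. g (i + n))"
        unfolding g by (intro suminf_ennreal2) (use g0 sg in \<open>auto simp: summable_iff_shift\<close>)
      also have "\<dots> \<le> ennreal e" using n by (rule ennreal_leI)
      finally have "?H (A - F) \<le> ?H (S n) + ennreal e" by (simp add: add_left_mono)
      then have "?H (A \<inter> F) + ?H (A - F) \<le> ?H (A \<inter> F) + (?H (S n) + ennreal e)"
        by (rule add_left_mono)
      also have "\<dots> = (?H (A \<inter> F) + ?H (S n)) + ennreal e" by (simp add: add_ac)
      also have "\<dots> \<le> ?H A + ennreal e" using S by (rule add_right_mono)
      finally show "?H (A \<inter> F) + ?H (A - F) \<le> ?H A + ennreal e" .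
    qed
  qed simp
  have "?H (A \<inter> F) + ?H (A - F) = ?H A" for A
  proof (rule antisym[OF main])
    have "?H A \<le> ?H ((A \<inter> F) \<union> (A - F))" by (intro surface_outer_measure_mono) auto
    also have "\<dots> \<le> ?H (A \<inter> F) + ?H (A - F)" by (rule surface_outer_measure_Un_le[OF d])
    finally show "?H A \<le> ?H (A \<inter> F) + ?H (A - F)" .
  qed
  then show ?thesis by (simp add: lambda_system_def Int_commute Diff_eq)
qed

lemma emeasure_surface_measure:
  fixes A :: "'a::euclidean_space set"
  assumes d: "2 \<le> DIM('a)" and A: "A \<in> sets borel"
  shows "emeasure surface_measure A = surface_outer_measure A"
proof -
  let ?L = "lambda_system UNIV UNIV (surface_outer_measure :: 'a set \<Rightarrow> ennreal)"
  interpret sigma_algebra UNIV "UNIV :: 'a set set" using sigma_algebra_Pow[of UNIV] by simp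
  have L: "measure_space UNIV ?L surface_outer_measure"
    by (rule caratheodory_lemma[OF surface_outer_measure_space[OF d]])
  then interpret L: sigma_algebra UNIV ?L by (simp add: measure_space_def)
  have "sigma_sets UNIV (Collect closed) \<subseteq> ?L"
    by (intro L.sigma_sets_subset) (use closed_in_lambda_system[OF d] in auto)
  then have sub: "sets borel \<subseteq> ?L" by (simp add: borel_eq_closed)
  have "countably_additive ?L surface_outer_measure" using L by (simp add: measure_space_def)
  then have ca: "countably_additive (sets (borel :: 'a measure)) surface_outer_measure"
    unfolding countably_additive_def using sub by (meson subset_trans subsetD)
  have pos: "positive (sets (borel :: 'a measure)) surface_outer_measure"
    using L by (simp add: measure_space_def positive_def)
  have sb: "sets (surface_measure :: 'a measure) = sets borel"
    by (simp add: surface_measure_def sets_measure_of[of _ UNIV, simplified] sets.sigma_sets_eq[of borel, simplified])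
  show ?thesis
    by (rule emeasure_measure_of[OF surface_measure_def]) (use A sb pos ca in auto)
qed


section \<open>Finite element spaces\<close>

definition polynomial_of_degree_le :: "nat \<Rightarrow> ('a::euclidean_space \<Rightarrow> complex) \<Rightarrow> bool" where
  "polynomial_of_degree_le k p \<longleftrightarrow>
     (\<exists>c. \<forall>x. p x = (\<Sum>\<alpha>\<in>{\<alpha> \<in> Basis \<rightarrow>\<^sub>E {..k}. sum \<alpha> Basis \<le> k}.
                       c \<alpha> * complex_of_real (\<Prod>b\<in>Basis. (x \<bullet> b) ^ \<alpha> b)))"

text \<open>
  The face-to-face condition is part of \<^const>\<open>triangulation\<close>.
\<close>

definition conforming_mesh :: "'a::euclidean_space set \<Rightarrow> 'a set set \<Rightarrow> bool" where
  "conforming_mesh \<Omega> \<T> \<longleftrightarrow>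
     triangulation \<T> \<and> (\<forall>T\<in>\<T>. int DIM('a) simplex T) \<and> \<Union>\<T> = closure \<Omega>"

definition mesh_size :: "'a::metric_space set set \<Rightarrow> real" where
  "mesh_size \<T> = Max (diameter ` \<T>)"

definition quasiuniform :: "real set \<Rightarrow> (real \<Rightarrow> 'a::metric_space set set) \<Rightarrow> bool" where
  "quasiuniform H \<T> \<longleftrightarrow> (\<exists>c>0. \<forall>h\<in>H. \<forall>T\<in>\<T> h. \<exists>x. cball x (c * h) \<subseteq> T)"

text \<open>
  Elements of the space are functions on the closure of the domain; they are represented by their
  extension by \<open>0\<close>, so that equality of functions on the whole space is equality on the closure.
\<close>

definition fe_space ::
    "'a::euclidean_space set \<Rightarrow> 'a set set \<Rightarrow> nat \<Rightarrow> ('a \<Rightarrow> complex) set" where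
  "fe_space \<Omega> \<T> k =
     {u. continuous_on (closure \<Omega>) u \<and>
         (\<forall>T\<in>\<T>. \<exists>p. polynomial_of_degree_le k p \<and> (\<forall>x\<in>T. u x = p x)) \<and>
         (\<forall>x. x \<notin> closure \<Omega> \<longrightarrow> u x = 0)}"

definition is_basis :: "('a \<Rightarrow> complex) set \<Rightarrow> nat \<Rightarrow> (nat \<Rightarrow> 'a \<Rightarrow> complex) \<Rightarrow> bool" where
  "is_basis V N \<psi> \<longleftrightarrow> (\<forall>i<N. \<psi> i \<in> V) \<and>
     (\<forall>u\<in>V. \<exists>!c. c \<in> carrier_vec N \<and> u = (\<lambda>x. \<Sum>i<N. (c $ i) * \<psi> i x))"


section \<open>Inner products and norms\<close>

definition l2_inner :: "'a::euclidean_space set \<Rightarrow> ('a \<Rightarrow> complex) \<Rightarrow> ('a \<Rightarrow> complex) \<Rightarrow> complex" where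
  "l2_inner \<Omega> f g = (LINT x|lebesgue_on \<Omega>. f x * cnj (g x))"

definition l2_norm :: "'a::euclidean_space set \<Rightarrow> ('a \<Rightarrow> complex) \<Rightarrow> real" where
  "l2_norm \<Omega> f = sqrt (LINT x|lebesgue_on \<Omega>. (cmod (f x))\<^sup>2)"

text \<open>
  A continuous piecewise polynomial is differentiable in the interior of each element, hence almost
  everywhere in the domain, and its weak gradient is the classical one there; the value \<open>0\<close> at the
  remaining points is immaterial.
\<close>

definition partial_deriv :: "('a::euclidean_space \<Rightarrow> complex) \<Rightarrow> 'a \<Rightarrow> 'a \<Rightarrow> complex" where
  "partial_deriv f b x = (if f differentiable (at x) then frechet_derivative f (at x) b else 0)"

definition grad_inner :: "'a::euclidean_space set \<Rightarrow> ('a \<Rightarrow> complex) \<Rightarrow> ('a \<Rightarrow> complex) \<Rightarrow> complex" where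
  "grad_inner \<Omega> f g = (LINT x|lebesgue_on \<Omega>. (\<Sum>b\<in>Basis. partial_deriv f b x * cnj (partial_deriv g b x)))"

definition boundary_inner ::
    "'a::euclidean_space set \<Rightarrow> ('a \<Rightarrow> complex) \<Rightarrow> ('a \<Rightarrow> complex) \<Rightarrow> complex" where
  "boundary_inner \<Gamma> f g = (LINT x:\<Gamma>|surface_measure. f x * cnj (g x))"


section \<open>Sesquilinear forms and operators into the dual space\<close>

definition form_T :: "'a::euclidean_space set \<Rightarrow> real \<Rightarrow> ('a \<Rightarrow> complex) \<Rightarrow> ('a \<Rightarrow> complex) \<Rightarrow> complex" where
  "form_T \<Omega> \<M> u v = of_real \<M> * grad_inner \<Omega> u v - \<i> * l2_inner \<Omega> u v"

definition form_P :: "'a::euclidean_space set \<Rightarrow> 'a set \<Rightarrow> real \<Rightarrow> real \<Rightarrow> real \<Rightarrow>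
    ('a \<Rightarrow> complex) \<Rightarrow> ('a \<Rightarrow> complex) \<Rightarrow> complex" where
  "form_P \<Omega> \<Gamma> \<gamma> \<M> \<Lambda> u v =
     (1 - \<i> * of_real (\<gamma> * \<Lambda>)) * (grad_inner \<Omega> u v - \<i> * of_real (sqrt \<gamma>) * boundary_inner \<Gamma> u v)
     - of_real (\<gamma> * (1 - \<Lambda> / \<M>) - \<Lambda> / \<M>) * l2_inner \<Omega> u v"

text \<open>
  Since the forms are antilinear in the second argument, the dual space consists of the antilinear
  functionals on \<open>V\<close> (\<^const>\<open>undefined\<close> outside \<open>V\<close>).
\<close>

definition antidual :: "('a \<Rightarrow> complex) set \<Rightarrow> (('a \<Rightarrow> complex) \<Rightarrow> complex) set" where
  "antidual V = {F \<in> extensional V. \<forall>u\<in>V. \<forall>v\<in>V. \<forall>c d.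
                   F (\<lambda>x. c * u x + d * v x) = cnj c * F u + cnj d * F v}"

definition form_operator ::
    "('a \<Rightarrow> complex) set \<Rightarrow> (('a \<Rightarrow> complex) \<Rightarrow> ('a \<Rightarrow> complex) \<Rightarrow> complex) \<Rightarrow>
     ('a \<Rightarrow> complex) \<Rightarrow> (('a \<Rightarrow> complex) \<Rightarrow> complex)" where
  "form_operator V a u = (\<lambda>v\<in>V. a u v)"

definition invertible_operator ::
    "('a \<Rightarrow> complex) set \<Rightarrow> (('a \<Rightarrow> complex) \<Rightarrow> (('a \<Rightarrow> complex) \<Rightarrow> complex)) \<Rightarrow> bool" where
  "invertible_operator V A \<longleftrightarrow> bij_betw A V (antidual V)"

definition dual_norm ::
    "'a::euclidean_space set \<Rightarrow> ('a \<Rightarrow> complex) set \<Rightarrow> (('a \<Rightarrow> complex) \<Rightarrow> complex) \<Rightarrow> ennreal" where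
  "dual_norm \<Omega> V F = (SUP v\<in>{v\<in>V. l2_norm \<Omega> v \<le> 1}. ennreal (cmod (F v)))"

text \<open>The operator norm of the inverse, as a map from the dual of \<open>V\<close> to \<open>V\<close> with the \<open>L\<^sup>2\<close> norm.\<close>

definition inverse_norm ::
    "'a::euclidean_space set \<Rightarrow> ('a \<Rightarrow> complex) set \<Rightarrow>
     (('a \<Rightarrow> complex) \<Rightarrow> (('a \<Rightarrow> complex) \<Rightarrow> complex)) \<Rightarrow> ennreal" where
  "inverse_norm \<Omega> V A =
     (SUP F\<in>{F \<in> antidual V. dual_norm \<Omega> V F \<le> 1}. ennreal (l2_norm \<Omega> (the_inv_into V A F)))"


section \<open>Matrices\<close>

definition mass_mat :: "'a::euclidean_space set \<Rightarrow> nat \<Rightarrow> (nat \<Rightarrow> 'a \<Rightarrow> complex) \<Rightarrow> complex mat" where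
  "mass_mat \<Omega> N \<psi> = mat N N (\<lambda>(i, j). l2_inner \<Omega> (\<psi> j) (\<psi> i))"

definition stiff_mat :: "'a::euclidean_space set \<Rightarrow> nat \<Rightarrow> (nat \<Rightarrow> 'a \<Rightarrow> complex) \<Rightarrow> complex mat" where
  "stiff_mat \<Omega> N \<psi> = mat N N (\<lambda>(i, j). grad_inner \<Omega> (\<psi> j) (\<psi> i))"

definition stiff_mat_\<gamma> ::
    "'a::euclidean_space set \<Rightarrow> 'a set \<Rightarrow> real \<Rightarrow> nat \<Rightarrow> (nat \<Rightarrow> 'a \<Rightarrow> complex) \<Rightarrow> complex mat" where
  "stiff_mat_\<gamma> \<Omega> \<Gamma> \<gamma> N \<psi> = mat N N (\<lambda>(i, j).
     grad_inner \<Omega> (\<psi> j) (\<psi> i) - \<i> * of_real (sqrt \<gamma>) * boundary_inner \<Gamma> (\<psi> j) (\<psi> i))"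

definition H_T :: "'a::euclidean_space set \<Rightarrow> real \<Rightarrow> nat \<Rightarrow> (nat \<Rightarrow> 'a \<Rightarrow> complex) \<Rightarrow> complex mat" where
  "H_T \<Omega> \<M> N \<psi> = of_real \<M> \<cdot>\<^sub>m stiff_mat \<Omega> N \<psi> - \<i> \<cdot>\<^sub>m mass_mat \<Omega> N \<psi>"

definition H_P :: "'a::euclidean_space set \<Rightarrow> 'a set \<Rightarrow> real \<Rightarrow> real \<Rightarrow> real \<Rightarrow>
    nat \<Rightarrow> (nat \<Rightarrow> 'a \<Rightarrow> complex) \<Rightarrow> complex mat" where
  "H_P \<Omega> \<Gamma> \<gamma> \<M> \<Lambda> N \<psi> =
     (1 - \<i> * of_real (\<gamma> * \<Lambda>)) \<cdot>\<^sub>m stiff_mat_\<gamma> \<Omega> \<Gamma> \<gamma> N \<psi>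
     - of_real (\<gamma> * (1 - \<Lambda> / \<M>) - \<Lambda> / \<M>) \<cdot>\<^sub>m mass_mat \<Omega> N \<psi>"

definition M_1 :: "'a::euclidean_space set \<Rightarrow> real \<Rightarrow> nat \<Rightarrow> (nat \<Rightarrow> 'a \<Rightarrow> complex) \<Rightarrow> complex mat" where
  "M_1 \<Omega> \<gamma> N \<psi> = (\<i> * of_real ((\<gamma> - 1) / \<gamma>)) \<cdot>\<^sub>m mass_mat \<Omega> N \<psi>"

definition M_2 :: "'a::euclidean_space set \<Rightarrow> real \<Rightarrow> real \<Rightarrow> real \<Rightarrow>
    nat \<Rightarrow> (nat \<Rightarrow> 'a \<Rightarrow> complex) \<Rightarrow> complex mat" where
  "M_2 \<Omega> \<gamma> \<M> \<Lambda> N \<psi> = of_real (\<gamma> * (1 - \<Lambda> / \<M>)) \<cdot>\<^sub>m mass_mat \<Omega> N \<psi>"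

definition system_mat :: "'a::euclidean_space set \<Rightarrow> 'a set \<Rightarrow> real \<Rightarrow> real \<Rightarrow> real \<Rightarrow>
    nat \<Rightarrow> (nat \<Rightarrow> 'a \<Rightarrow> complex) \<Rightarrow> complex mat" where
  "system_mat \<Omega> \<Gamma> \<gamma> \<M> \<Lambda> N \<psi> =
     four_block_mat (H_T \<Omega> \<M> N \<psi>) (M_1 \<Omega> \<gamma> N \<psi>)
                    (M_2 \<Omega> \<gamma> \<M> \<Lambda> N \<psi>) (H_P \<Omega> \<Gamma> \<gamma> \<M> \<Lambda> N \<psi>)"

definition gauss_seidel_mat :: "'a::euclidean_space set \<Rightarrow> 'a set \<Rightarrow> real \<Rightarrow> real \<Rightarrow> real \<Rightarrow>
    nat \<Rightarrow> (nat \<Rightarrow> 'a \<Rightarrow> complex) \<Rightarrow> complex mat" where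
  "gauss_seidel_mat \<Omega> \<Gamma> \<gamma> \<M> \<Lambda> N \<psi> =
     four_block_mat (H_T \<Omega> \<M> N \<psi>) (0\<^sub>m N N)
                    (M_2 \<Omega> \<gamma> \<M> \<Lambda> N \<psi>) (H_P \<Omega> \<Gamma> \<gamma> \<M> \<Lambda> N \<psi>)"


section \<open>Generalized eigenvalues\<close>

definition gen_eigenvalue :: "complex mat \<Rightarrow> complex mat \<Rightarrow> complex \<Rightarrow> bool" where
  "gen_eigenvalue A B \<mu> \<longleftrightarrow>
     (\<exists>v \<in> carrier_vec (dim_col A). v \<noteq> 0\<^sub>v (dim_col A) \<and> A *\<^sub>v v = \<mu> \<cdot>\<^sub>v (B *\<^sub>v v))"

text \<open>Algebraic multiplicity: order of the zero of \<open>z \<mapsto> det (z B - A)\<close>.\<close>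

definition gen_char_poly :: "complex mat \<Rightarrow> complex mat \<Rightarrow> complex poly" where
  "gen_char_poly A B =
     Determinant.det (mat (dim_row A) (dim_col A) (\<lambda>(i, j). [:- (A $$ (i, j)), B $$ (i, j):]))"

definition gen_multiplicity :: "complex mat \<Rightarrow> complex mat \<Rightarrow> complex \<Rightarrow> nat" where
  "gen_multiplicity A B \<mu> = Polynomial.order \<mu> (gen_char_poly A B)"

end

(* With s = mu - 1, the pencil mu B - A has the blocks s H_T, -M_1 / s M_2, s H_P. Its first block
   column is divisible by s, which gives a factor s^N; the remaining factor is nonzero at s = 0
   because M_1 and M_2 are invertible, and the degree is 2N because B is. For s \<noteq> 0, an
   eigenvector solves s H_T T = M_1 P and H_P P = -M_2 T, and applying the two inverse bounds in
   turn yields |s| \<le> C_T C_P (gamma - 1) |1 - Lambda/M|.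

   The boundary part may have infinite surface measure, so linearity of the boundary integral is
   not available from integrability. It is instead read off from the hypothesis that the operators
   map into the antidual: the L2 part is sesquilinear, so form_T forces the gradient part and then
   form_P forces the boundary part to be antilinear in the second argument; Hermitian symmetry,
   which holds for the Bochner integral without integrability, does the rest. *)

theory Submission
  imports Defs
begin

section \<open>Block matrix pencils\<close>

lemma poly_gen_char_poly:
  assumes "A \<in> carrier_mat n n" "B \<in> carrier_mat n n"
  shows "poly (gen_char_poly A B) \<mu> = Determinant.det (\<mu> \<cdot>\<^sub>m B - A)"
  unfolding gen_char_poly_def by (rule poly_det_cong[of _ n]) (use assms in auto)

text \<open>An eigenvector is a nonzero kernel vector of \<open>\<mu> \<cdot>\<^sub>m B - A\<close>,
  and such a vector exists exactly when the determinant of that matrix vanishes.\<close>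

lemma gen_eigenvalue_iff_root:
  assumes A: "A \<in> carrier_mat n n" and B: "B \<in> carrier_mat n n"
  shows "gen_eigenvalue A B \<mu> \<longleftrightarrow> poly (gen_char_poly A B) \<mu> = 0"
proof -
  have "(\<mu> \<cdot>\<^sub>m B - A) *\<^sub>v v = 0\<^sub>v n \<longleftrightarrow> A *\<^sub>v v = \<mu> \<cdot>\<^sub>v (B *\<^sub>v v)" if v: "v \<in> carrier_vec n" for v
  proof -
    have "(\<mu> \<cdot>\<^sub>m B - A) *\<^sub>v v = \<mu> \<cdot>\<^sub>v (B *\<^sub>v v) - A *\<^sub>v v"
      using A B v
      by (subst minus_mult_distrib_mat_vec[of _ n n]) (auto simp: smult_scalar_prod_distrib[of _ n])
    moreover have "\<mu> \<cdot>\<^sub>v (B *\<^sub>v v) - A *\<^sub>v v = 0\<^sub>v n \<longleftrightarrow> A *\<^sub>v v = \<mu> \<cdot>\<^sub>v (B *\<^sub>v v)"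
      using A B v by (auto simp: vec_eq_iff)
    ultimately show ?thesis by simp
  qed
  then show ?thesis
    using A B unfolding poly_gen_char_poly[OF A B] gen_eigenvalue_def
    by (subst det_0_iff_vec_prod_zero[of _ n]) auto
qed

text \<open>With \<open>C\<close> inverse to \<open>B\<close>, \<open>\<mu> B - A\<close> factors as
  \<open>B (\<mu> I - C A)\<close>. The polynomial is therefore \<open>det B\<close> times the monic
  characteristic polynomial of \<open>C * A\<close>.\<close>

lemma degree_gen_char_poly:
  assumes A: "A \<in> carrier_mat n n" and B: "B \<in> carrier_mat n n" and det: "Determinant.det B \<noteq> 0"
  shows "degree (gen_char_poly A B) = n"
proof -
  obtain C where C: "C \<in> carrier_mat n n" "B * C = 1\<^sub>m n"
    using det_non_zero_imp_unit[OF B det] by (auto simp: Units_def ring_mat_def)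
  have "gen_char_poly A B = Polynomial.smult (Determinant.det B) (char_poly (C * A))"
  proof (intro poly_ext)
    fix \<mu>
    have BCA: "B * (C * A) = A" using assoc_mult_mat[of B n n C n A n] A B C by simp
    have "poly (gen_char_poly A B) \<mu> = Determinant.det (\<mu> \<cdot>\<^sub>m B - A)"
      by (rule poly_gen_char_poly[OF A B])
    also have "\<mu> \<cdot>\<^sub>m B - A = B * (\<mu> \<cdot>\<^sub>m 1\<^sub>m n - C * A)"
      using A B C by (simp add: mult_minus_distrib_mat[of _ n n _ n] mult_smult_distrib[of _ n n _ n] BCA)
    also have "Determinant.det \<dots> = Determinant.det B * Determinant.det (\<mu> \<cdot>\<^sub>m 1\<^sub>m n - C * A)"
      by (rule det_mult[of _ n]) (use A B C in auto)
    also have "Determinant.det (\<mu> \<cdot>\<^sub>m 1\<^sub>m n - C * A) = poly (char_poly (C * A)) \<mu>"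
      unfolding char_poly_def
      by (rule poly_det_cong[of _ n, symmetric]) (use A C in \<open>auto simp: char_poly_matrix_def\<close>)
    finally show "poly (gen_char_poly A B) \<mu> = poly (Polynomial.smult (Determinant.det B) (char_poly (C * A))) \<mu>"
      by simp
  qed
  with degree_monic_char_poly[of "C * A" n] C A det show ?thesis by simp
qed

text \<open>Complex polynomials split, so the root multiset \<open>proots p\<close> has size
  \<open>degree p\<close>; its size is the sum of its counts, which are the orders.\<close>

lemma sum_order_roots:
  fixes p :: "complex poly"
  assumes "p \<noteq> 0"
  shows "(\<Sum>z | poly p z = 0. Polynomial.order z p) = degree p"
  using assms size_proots_complex[of p] by (simp add: size_multiset_overloaded_eq)

section \<open>Spectrum and eigenvectors of the block Gauss-Seidel pencil\<close>

lemma block_gauss_seidel_spectrum: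
  fixes T M1 M2 P :: "complex mat"
  assumes [simp]: "T \<in> carrier_mat N N" "M1 \<in> carrier_mat N N" "M2 \<in> carrier_mat N N" "P \<in> carrier_mat N N"
    and det: "Determinant.det T \<noteq> 0" "Determinant.det M1 \<noteq> 0" "Determinant.det M2 \<noteq> 0" "Determinant.det P \<noteq> 0"
    and A: "A = four_block_mat T M1 M2 P" and B: "B = four_block_mat T (0\<^sub>m N N) M2 P"
  shows "gen_multiplicity A B 1 = N"
    and "(\<Sum>\<mu> | gen_eigenvalue A B \<mu> \<and> \<mu> \<noteq> 1. gen_multiplicity A B \<mu>) = N"
proof -
  have car: "A \<in> carrier_mat (N + N) (N + N)" "B \<in> carrier_mat (N + N) (N + N)"
    by (auto simp: A B)
  note dims = assms(1-4)[THEN carrier_matD(1)] assms(1-4)[THEN carrier_matD(2)]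
  \<comment> \<open>The cofactor of \<open>(\<mu> - 1)^N\<close> has to be a polynomial in
    \<open>\<mu>\<close>. This auxiliary pencil is chosen so that \<open>\<mu> B' - A'\<close> is
    the original pencil with \<open>\<mu> - 1\<close> divided out of its first block column; its
    characteristic polynomial \<open>q\<close> is then the cofactor.\<close>
  define A' where "A' = four_block_mat (- T) M1 (- M2) P"
  define B' where "B' = four_block_mat (0\<^sub>m N N) (0\<^sub>m N N) (0\<^sub>m N N) P"
  have car': "A' \<in> carrier_mat (N + N) (N + N)" "B' \<in> carrier_mat (N + N) (N + N)"
    by (auto simp: A'_def B'_def)
  define p where "p = gen_char_poly A B"
  define q where "q = gen_char_poly A' B'"
  have q: "poly q \<mu> = Determinant.det (four_block_mat T (- M1) M2 ((\<mu> - 1) \<cdot>\<^sub>m P))" for \<mu>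
  proof -
    have "\<mu> \<cdot>\<^sub>m B' - A' = four_block_mat T (- M1) M2 ((\<mu> - 1) \<cdot>\<^sub>m P)"
      by (rule eq_matI) (auto simp: A'_def B'_def dims left_diff_distrib)
    then show ?thesis unfolding q_def poly_gen_char_poly[OF car'] by simp
  qed
  have "poly p \<mu> = poly ([:-1, 1:] ^ N * q) \<mu>" for \<mu>
  proof -
    let ?F = "four_block_mat T (- M1) M2 ((\<mu> - 1) \<cdot>\<^sub>m P)"
    \<comment> \<open>Right multiplication by \<open>?D\<close> scales the first block column by
      \<open>\<mu> - 1\<close> and leaves the second one alone; \<open>det ?D\<close> supplies the
      factor \<open>(\<mu> - 1)^N\<close>.\<close>
    let ?D = "four_block_mat ((\<mu> - 1) \<cdot>\<^sub>m 1\<^sub>m N) (0\<^sub>m N N) (0\<^sub>m N N) (1\<^sub>m N)"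
    have "\<mu> \<cdot>\<^sub>m B - A = four_block_mat ((\<mu> - 1) \<cdot>\<^sub>m T) (- M1) ((\<mu> - 1) \<cdot>\<^sub>m M2) ((\<mu> - 1) \<cdot>\<^sub>m P)"
      by (rule eq_matI) (auto simp: A B dims left_diff_distrib)
    also have "\<dots> = ?F * ?D"
      by (subst mult_four_block_mat[of _ N N _ N _ N])
        (auto simp: mult_smult_distrib[of _ N N _ N] left_mult_one_mat[of _ N N] right_mult_one_mat[of _ N N]
          right_mult_zero_mat[of _ N N])
    finally have "poly p \<mu> = Determinant.det ?F * Determinant.det ?D"
      unfolding p_def poly_gen_char_poly[OF car] by (simp add: det_mult[of _ "N + N"])
    also have "Determinant.det ?D = (\<mu> - 1) ^ N"
      by (subst det_four_block_mat_upper_right_zero[of _ N _ N]) auto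
    finally show ?thesis by (simp add: q algebra_simps)
  qed
  then have pq: "p = [:-1, 1:] ^ N * q" by (intro poly_ext) auto
  \<comment> \<open>At \<open>\<mu> = 1\<close> the lower right block vanishes. A kernel vector
    \<open>(x, y)\<close> then satisfies \<open>M2 x = 0\<close>, so \<open>x = 0\<close>, after
    which the first row reads \<open>M1 y = 0\<close>, so \<open>y = 0\<close>.\<close>
  have q1: "poly q 1 \<noteq> 0"
  proof
    assume "poly q 1 = 0"
    moreover have "four_block_mat T (- M1) M2 ((1 - 1) \<cdot>\<^sub>m P) = four_block_mat T (- M1) M2 (0\<^sub>m N N)"
      by (rule eq_matI) (auto simp: dims)
    ultimately have "Determinant.det (four_block_mat T (- M1) M2 (0\<^sub>m N N)) = 0" unfolding q by simp
    then obtain v where v: "v \<in> carrier_vec (N + N)" "v \<noteq> 0\<^sub>v (N + N)"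
      "four_block_mat T (- M1) M2 (0\<^sub>m N N) *\<^sub>v v = 0\<^sub>v (N + N)"
      by (subst (asm) det_0_iff_vec_prod_zero[of _ "N + N"]) auto
    define x where "x = vec_first v N"
    define y where "y = vec_last v N"
    have xy: "x \<in> carrier_vec N" "y \<in> carrier_vec N" and vxy: "v = x @\<^sub>v y"
      using v(1) by (auto simp: x_def y_def)
    have eq: "(T *\<^sub>v x + - M1 *\<^sub>v y) @\<^sub>v (M2 *\<^sub>v x + 0\<^sub>m N N *\<^sub>v y) = 0\<^sub>v N @\<^sub>v 0\<^sub>v N"
      using v(3) xy unfolding vxy
      by (subst (asm) four_block_mat_mult_vec[of _ N N _ N _ N]) auto
    have "T *\<^sub>v x + - M1 *\<^sub>v y \<in> carrier_vec N"
      by (intro add_carrier_vec mult_mat_vec_carrier[OF _ xy(1)] mult_mat_vec_carrier[OF _ xy(2)]) simp_all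
    from iffD1[OF append_vec_eq[OF this zero_carrier_vec] eq]
    have e: "T *\<^sub>v x + - M1 *\<^sub>v y = 0\<^sub>v N" "M2 *\<^sub>v x + 0\<^sub>m N N *\<^sub>v y = 0\<^sub>v N"
      by simp_all
    have z: "0\<^sub>m N N *\<^sub>v y = 0\<^sub>v N" using xy by auto
    have x0: "x = 0\<^sub>v N"
      using e(2) z xy det(3) mult_mat_vec_carrier[OF assms(3) xy(1)] det_0_iff_vec_prod_zero[of M2 N] by auto
    have "T *\<^sub>v x = 0\<^sub>v N" unfolding x0 by (rule eq_vecI) (auto simp: dims)
    then have "M1 *\<^sub>v y = 0\<^sub>v N"
      using e(1) xy by (auto simp: vec_eq_iff dims carrier_vecD simp del: index_mult_mat_vec)
    then have "y = 0\<^sub>v N" using xy det(2) det_0_iff_vec_prod_zero[of M1 N] by auto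
    then have "v = 0\<^sub>v (N + N)" unfolding vxy x0 by (intro eq_vecI) auto
    with v(2) show False by simp
  qed
  then have q0: "q \<noteq> 0" by auto
  then have p0: "p \<noteq> 0" by (simp add: pq)
  have "Polynomial.order 1 p = N"
    using q1 p0 unfolding pq by (simp add: order_mult order_power_n_n order_root order_0I)
  then show m1: "gen_multiplicity A B 1 = N" by (simp add: gen_multiplicity_def p_def)
  have "Determinant.det B \<noteq> 0"
    unfolding B using det by (subst det_four_block_mat_upper_right_zero[of _ N _ N]) auto
  from degree_gen_char_poly[OF car this] have "degree p = N + N" by (simp add: p_def)
  \<comment> \<open>The root 1 is split off from the sum. The case where 1 is not a root occurs for
    \<open>N = 0\<close>; its order is then 0 and the identity persists.\<close>
  moreover have "(\<Sum>z | poly p z = 0. Polynomial.order z p)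
      = Polynomial.order 1 p + (\<Sum>z | poly p z = 0 \<and> z \<noteq> 1. Polynomial.order z p)"
  proof (cases "poly p 1 = 0")
    case True
    have "{z. poly p z = 0} = insert 1 {z. poly p z = 0 \<and> z \<noteq> 1}" using True by auto
    then show ?thesis using poly_roots_finite[OF p0] by simp
  next
    case False
    then have "{z. poly p z = 0 \<and> z \<noteq> 1} = {z. poly p z = 0}" by auto
    then show ?thesis using False by (simp add: order_0I)
  qed
  ultimately show "(\<Sum>\<mu> | gen_eigenvalue A B \<mu> \<and> \<mu> \<noteq> 1. gen_multiplicity A B \<mu>) = N"
    using m1 sum_order_roots[OF p0]
    by (simp add: gen_eigenvalue_iff_root[OF car] gen_multiplicity_def p_def)
qed

text \<open>The second block rows of \<open>A\<close> and \<open>B\<close> coincide, so that row of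
  the eigenvalue equation is \<open>(\<mu> - 1) (M2 x + P y) = 0\<close> and
  \<open>\<mu> - 1\<close> cancels. The equations are stated by components because each component
  will be read as a test against one basis function.\<close>

lemma block_gauss_seidel_eigenvector:
  assumes AB: "A = four_block_mat T M1 M2 P" "B = four_block_mat T (0\<^sub>m N N) M2 P"
    and [simp]: "T \<in> carrier_mat N N" "M1 \<in> carrier_mat N N" "M2 \<in> carrier_mat N N" "P \<in> carrier_mat N N"
    and ev: "gen_eigenvalue A B \<mu>" and ne: "\<mu> \<noteq> 1"
  obtains x y where "x \<in> carrier_vec N" "y \<in> carrier_vec N" "x \<noteq> 0\<^sub>v N \<or> y \<noteq> 0\<^sub>v N"
    and "\<And>i. i < N \<Longrightarrow> (\<mu> - 1) * (T *\<^sub>v x) $ i = (M1 *\<^sub>v y) $ i"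
    and "\<And>i. i < N \<Longrightarrow> (P *\<^sub>v y) $ i = - (M2 *\<^sub>v x) $ i"
proof -
  obtain v where v: "v \<in> carrier_vec (N + N)" "v \<noteq> 0\<^sub>v (N + N)" "A *\<^sub>v v = \<mu> \<cdot>\<^sub>v (B *\<^sub>v v)"
    using ev by (auto simp: gen_eigenvalue_def AB carrier_matD[OF assms(3)] carrier_matD[OF assms(6)])
  define x where "x = vec_first v N"
  define y where "y = vec_last v N"
  have xy: "x \<in> carrier_vec N" "y \<in> carrier_vec N" and vxy: "v = x @\<^sub>v y"
    using v(1) by (auto simp: x_def y_def)
  have z: "0\<^sub>m N N *\<^sub>v y = 0\<^sub>v N" using xy by auto
  have "A *\<^sub>v v = (T *\<^sub>v x + M1 *\<^sub>v y) @\<^sub>v (M2 *\<^sub>v x + P *\<^sub>v y)"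
    unfolding AB vxy by (rule four_block_mat_mult_vec[of _ N N _ N _ N]) (use xy in auto)
  moreover have "B *\<^sub>v v = T *\<^sub>v x @\<^sub>v (M2 *\<^sub>v x + P *\<^sub>v y)"
    unfolding AB vxy by (subst four_block_mat_mult_vec[of _ N N _ N _ N]) (use xy z mult_mat_vec_carrier[OF assms(3) xy(1)] in auto)
  moreover have "\<mu> \<cdot>\<^sub>v (T *\<^sub>v x @\<^sub>v (M2 *\<^sub>v x + P *\<^sub>v y)) =
      \<mu> \<cdot>\<^sub>v (T *\<^sub>v x) @\<^sub>v \<mu> \<cdot>\<^sub>v (M2 *\<^sub>v x + P *\<^sub>v y)"
    by (rule eq_vecI) (auto simp: carrier_matD[OF assms(3)] carrier_matD[OF assms(6)])
  ultimately have eq: "(T *\<^sub>v x + M1 *\<^sub>v y) @\<^sub>v (M2 *\<^sub>v x + P *\<^sub>v y) =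
      \<mu> \<cdot>\<^sub>v (T *\<^sub>v x) @\<^sub>v \<mu> \<cdot>\<^sub>v (M2 *\<^sub>v x + P *\<^sub>v y)"
    using v(3) by simp
  have "T *\<^sub>v x + M1 *\<^sub>v y \<in> carrier_vec N" "\<mu> \<cdot>\<^sub>v (T *\<^sub>v x) \<in> carrier_vec N"
    by (simp_all add: mult_mat_vec_carrier[OF assms(3) xy(1)] mult_mat_vec_carrier[OF assms(4) xy(2)])
  note iffD1[OF append_vec_eq[OF this] eq]
  then have e: "T *\<^sub>v x + M1 *\<^sub>v y = \<mu> \<cdot>\<^sub>v (T *\<^sub>v x)" "M2 *\<^sub>v x + P *\<^sub>v y = \<mu> \<cdot>\<^sub>v (M2 *\<^sub>v x + P *\<^sub>v y)"
    by (rule conjunct1, rule conjunct2)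
  note dims = assms(3-6)[THEN carrier_matD(1)]
  show ?thesis
  proof
    show "x \<noteq> 0\<^sub>v N \<or> y \<noteq> 0\<^sub>v N" using v(2) vxy by auto
    fix i assume i: "i < N"
    have "(T *\<^sub>v x) $ i + (M1 *\<^sub>v y) $ i = \<mu> * (T *\<^sub>v x) $ i"
      using arg_cong[OF e(1), of "\<lambda>w. w $ i"] i by (simp add: dims del: index_mult_mat_vec)
    then show "(\<mu> - 1) * (T *\<^sub>v x) $ i = (M1 *\<^sub>v y) $ i"
      by (simp only: left_diff_distrib mult_1_left diff_eq_eq add.commute)
    have "(M2 *\<^sub>v x) $ i + (P *\<^sub>v y) $ i = \<mu> * ((M2 *\<^sub>v x) $ i + (P *\<^sub>v y) $ i)"
      using arg_cong[OF e(2), of "\<lambda>w. w $ i"] i by (simp add: dims del: index_mult_mat_vec)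
    then have "(\<mu> - 1) * ((M2 *\<^sub>v x) $ i + (P *\<^sub>v y) $ i) = 0" by (simp only: left_diff_distrib) simp
    then have "(M2 *\<^sub>v x) $ i + (P *\<^sub>v y) $ i = 0" using ne by simp
    then show "(P *\<^sub>v y) $ i = - (M2 *\<^sub>v x) $ i" by (simp only: eq_neg_iff_add_eq_0 add.commute)
  qed (fact xy)+
qed

section \<open>Sesquilinear forms and their matrices\<close>

text \<open>A complex subspace of functions. The two-term combination has the same shape as in
  \<open>antidual\<close>, so the two can be matched directly; nonemptiness provides the zero
  function.\<close>

definition linear_family :: "('a \<Rightarrow> complex) set \<Rightarrow> bool" where
  "linear_family V \<longleftrightarrow> V \<noteq> {} \<and> (\<forall>u\<in>V. \<forall>v\<in>V. \<forall>c d. (\<lambda>x. c * u x + d * v x) \<in> V)"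

lemma linear_familyD:
  "linear_family V \<Longrightarrow> u \<in> V \<Longrightarrow> v \<in> V \<Longrightarrow> (\<lambda>x. c * u x + d * v x) \<in> V"
  by (simp add: linear_family_def)

text \<open>Relative to \<open>V\<close>, since the integrals in question are not additive on
  arbitrary functions: a Bochner integral is 0 where integrability fails.\<close>

definition sesquilinear_on ::
    "('a \<Rightarrow> complex) set \<Rightarrow> (('a \<Rightarrow> complex) \<Rightarrow> ('a \<Rightarrow> complex) \<Rightarrow> complex) \<Rightarrow> bool" where
  "sesquilinear_on V a \<longleftrightarrow> (\<forall>u\<in>V. \<forall>v\<in>V. \<forall>w\<in>V. \<forall>c d.
     a (\<lambda>x. c * u x + d * v x) w = c * a u w + d * a v w \<and>
     a w (\<lambda>x. c * u x + d * v x) = cnj c * a w u + cnj d * a w v)"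

lemma sesquilinear_onD1:
  "sesquilinear_on V a \<Longrightarrow> u \<in> V \<Longrightarrow> v \<in> V \<Longrightarrow> w \<in> V \<Longrightarrow>
   a (\<lambda>x. c * u x + d * v x) w = c * a u w + d * a v w"
  by (auto simp: sesquilinear_on_def)

lemma sesquilinear_onD2:
  "sesquilinear_on V a \<Longrightarrow> u \<in> V \<Longrightarrow> v \<in> V \<Longrightarrow> w \<in> V \<Longrightarrow>
   a w (\<lambda>x. c * u x + d * v x) = cnj c * a w u + cnj d * a w v"
  by (auto simp: sesquilinear_on_def)

text \<open>Conjugating antilinearity in the second argument gives linearity in the first, so only
  one argument has to be treated for each form.\<close>

lemma hermitian_sesquilinear_on:
  assumes "\<And>u v. a u v = cnj (a v u)"
    and "\<And>u v w c d. u \<in> V \<Longrightarrow> v \<in> V \<Longrightarrow> w \<in> V \<Longrightarrow>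
      a w (\<lambda>x. c * u x + d * v x) = cnj c * a w u + cnj d * a w v"
  shows "sesquilinear_on V a"
  unfolding sesquilinear_on_def
proof (intro ballI allI conjI)
  fix u v w c d assume V: "u \<in> V" "v \<in> V" "w \<in> V"
  show "a w (\<lambda>x. c * u x + d * v x) = cnj c * a w u + cnj d * a w v" by (rule assms(2)[OF V])
  then have "cnj (a w (\<lambda>x. c * u x + d * v x)) = c * cnj (a w u) + d * cnj (a w v)" by simp
  then show "a (\<lambda>x. c * u x + d * v x) w = c * a u w + d * a v w"
    using assms(1)[of _ w] by simp
qed

lemma sesquilinear_on_lincomb:
  assumes "sesquilinear_on V a" "sesquilinear_on V b"
  shows "sesquilinear_on V (\<lambda>u v. y * a u v + z * b u v)"
  using assms unfolding sesquilinear_on_def by (simp add: algebra_simps)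

lemma linear_family_scale:
  assumes "linear_family V" "u \<in> V"
  shows "(\<lambda>x. c * u x) \<in> V"
  using linear_familyD[OF assms(1,2,2), of c 0] by simp

lemma sesquilinear_on_scale:
  assumes "sesquilinear_on V a" "u \<in> V" "v \<in> V"
  shows "a (\<lambda>x. c * u x) v = c * a u v"
  using sesquilinear_onD1[OF assms(1,2,2,3), of c 0] by simp

lemma linear_family_zero:
  assumes "linear_family V"
  shows "(\<lambda>x. 0) \<in> V"
proof -
  obtain u where "u \<in> V" using assms by (auto simp: linear_family_def)
  from linear_family_scale[OF assms this, of 0] show ?thesis by simp
qed

lemma linear_family_sum:
  fixes n :: nat
  assumes "linear_family V" "\<And>i. i < n \<Longrightarrow> f i \<in> V"
  shows "(\<lambda>x. \<Sum>i<n. c i * f i x) \<in> V"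
  using assms(2)
proof (induction n)
  case 0 then show ?case using linear_family_zero[OF assms(1)] by simp
next
  case (Suc n)
  have "(\<lambda>x. \<Sum>i<n. c i * f i x) \<in> V" "f n \<in> V" using Suc by auto
  from linear_familyD[OF assms(1) this, of 1 "c n"] show ?case by simp
qed

lemma sesquilinear_on_zero:
  assumes "linear_family V" "sesquilinear_on V a" "v \<in> V"
  shows "a (\<lambda>x. 0) v = 0" "a v (\<lambda>x. 0) = 0"
  using sesquilinear_onD1[OF assms(2,3,3,3), of 0 0] sesquilinear_onD2[OF assms(2,3,3,3), of 0 0]
  by simp_all

lemma sesquilinear_on_sum_left:
  fixes n :: nat
  assumes "linear_family V" "sesquilinear_on V a" "v \<in> V" "\<And>i. i < n \<Longrightarrow> f i \<in> V"
  shows "a (\<lambda>x. \<Sum>i<n. c i * f i x) v = (\<Sum>i<n. c i * a (f i) v)"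
  using assms(4)
proof (induction n)
  case 0 then show ?case using sesquilinear_on_zero[OF assms(1-3)] by simp
next
  case (Suc n)
  have "(\<lambda>x. \<Sum>i<n. c i * f i x) \<in> V" by (rule linear_family_sum[OF assms(1)]) (use Suc in auto)
  from sesquilinear_onD1[OF assms(2) this, of "f n" v 1 "c n"] Suc assms(3) show ?case by simp
qed

lemma sesquilinear_on_sum_right:
  fixes n :: nat
  assumes "linear_family V" "sesquilinear_on V a" "v \<in> V" "\<And>i. i < n \<Longrightarrow> f i \<in> V"
  shows "a v (\<lambda>x. \<Sum>i<n. c i * f i x) = (\<Sum>i<n. cnj (c i) * a v (f i))"
  using assms(4)
proof (induction n)
  case 0 then show ?case using sesquilinear_on_zero[OF assms(1-3)] by simp
next
  case (Suc n)
  have "(\<lambda>x. \<Sum>i<n. c i * f i x) \<in> V" by (rule linear_family_sum[OF assms(1)]) (use Suc in auto)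
  from sesquilinear_onD2[OF assms(2) this, of "f n" v 1 "c n"] Suc assms(3) show ?case by simp
qed

section \<open>Matrices of forms with respect to a basis\<close>

definition form_mat :: "(('a \<Rightarrow> complex) \<Rightarrow> ('a \<Rightarrow> complex) \<Rightarrow> complex) \<Rightarrow> nat \<Rightarrow>
    (nat \<Rightarrow> 'a \<Rightarrow> complex) \<Rightarrow> complex mat" where
  "form_mat a N \<psi> = mat N N (\<lambda>(i, j). a (\<psi> j) (\<psi> i))"

lemma form_mat_carrier [simp]: "form_mat a N \<psi> \<in> carrier_mat N N"
  by (simp add: form_mat_def)

definition basis_comb :: "nat \<Rightarrow> (nat \<Rightarrow> 'a \<Rightarrow> complex) \<Rightarrow> complex vec \<Rightarrow> 'a \<Rightarrow> complex" where
  "basis_comb N \<psi> c = (\<lambda>x. \<Sum>i<N. c $ i * \<psi> i x)"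

text \<open>The bridge from matrix to variational equations. The column index sits in the first,
  linear argument of the form, so the sum over columns moves inside and row \<open>i\<close> tests
  the combined function against \<open>\<psi> i\<close>.\<close>

lemma form_mat_mult_vec:
  assumes V: "linear_family V" "is_basis V N \<psi>" "sesquilinear_on V a"
    and c: "c \<in> carrier_vec N" and i: "i < N"
  shows "(form_mat a N \<psi> *\<^sub>v c) $ i = a (basis_comb N \<psi> c) (\<psi> i)"
proof -
  have \<psi>: "\<psi> i \<in> V" if "i < N" for i using V(2) that by (auto simp: is_basis_def)
  show ?thesis
    using i c sesquilinear_on_sum_left[where f = \<psi> and n = N and c = "\<lambda>i. c $ i", OF V(1,3) \<psi>[OF i] \<psi>]
    by (auto simp: form_mat_def basis_comb_def scalar_prod_def lessThan_atLeast0 mult.commute intro!: sum.cong)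
qed

lemma basis_comb_in:
  assumes "linear_family V" "is_basis V N \<psi>"
  shows "basis_comb N \<psi> c \<in> V"
  unfolding basis_comb_def using assms by (intro linear_family_sum) (auto simp: is_basis_def)

lemma basis_comb_eq_zero_iff:
  assumes "linear_family V" "is_basis V N \<psi>" "c \<in> carrier_vec N"
  shows "basis_comb N \<psi> c = (\<lambda>x. 0) \<longleftrightarrow> c = 0\<^sub>v N"
proof
  have *: "basis_comb N \<psi> (0\<^sub>v N) = (\<lambda>x. 0)" by (auto simp: basis_comb_def)
  then show "c = 0\<^sub>v N \<Longrightarrow> basis_comb N \<psi> c = (\<lambda>x. 0)" by simp
  assume "basis_comb N \<psi> c = (\<lambda>x. 0)"
  moreover have "\<exists>!c. c \<in> carrier_vec N \<and> (\<lambda>x. 0) = basis_comb N \<psi> c"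
    using assms(2) linear_family_zero[OF assms(1)] unfolding is_basis_def basis_comb_def by blast
  ultimately show "c = 0\<^sub>v N" using * assms(3) by (metis zero_carrier_vec)
qed

text \<open>Antilinearity in the second argument extends the equation from the basis to all of
  \<open>V\<close>. Different first arguments are allowed because the eigenvector equations couple
  two forms at two functions.\<close>

lemma sesquilinear_on_eq_if_eq_on_basis:
  assumes V: "linear_family V" "is_basis V N \<psi>" "sesquilinear_on V a" "sesquilinear_on V b"
    and "u \<in> V" "w \<in> V" "v \<in> V" and eq: "\<And>i. i < N \<Longrightarrow> a u (\<psi> i) = b w (\<psi> i)"
  shows "a u v = b w v"
proof -
  have \<psi>: "\<psi> i \<in> V" if "i < N" for i using V(2) that by (auto simp: is_basis_def)
  obtain e where v: "v = (\<lambda>x. \<Sum>i<N. e $ i * \<psi> i x)"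
    using V(2) \<open>v \<in> V\<close> by (auto simp: is_basis_def)
  show ?thesis
    unfolding v using eq \<psi> by (simp add: sesquilinear_on_sum_right[OF V(1,3) \<open>u \<in> V\<close>]
        sesquilinear_on_sum_right[OF V(1,4) \<open>w \<in> V\<close>])
qed

text \<open>A kernel vector of the matrix is the coordinate vector of a function that the form
  annihilates against every basis function, hence against all of \<open>V\<close>; by
  \<open>inj\<close> this function and its coordinates vanish.\<close>

lemma det_form_mat_nonzero:
  assumes V: "linear_family V" "is_basis V N \<psi>" "sesquilinear_on V a"
    and inj: "\<And>u. u \<in> V \<Longrightarrow> (\<And>v. v \<in> V \<Longrightarrow> a u v = 0) \<Longrightarrow> u = (\<lambda>x. 0)"
  shows "Determinant.det (form_mat a N \<psi>) \<noteq> 0"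
proof
  assume "Determinant.det (form_mat a N \<psi>) = 0"
  then obtain c where c: "c \<in> carrier_vec N" "c \<noteq> 0\<^sub>v N" "form_mat a N \<psi> *\<^sub>v c = 0\<^sub>v N"
    using det_0_iff_vec_prod_zero[OF form_mat_carrier, of a N \<psi>] by auto
  have z: "sesquilinear_on V (\<lambda>u v. 0)" by (simp add: sesquilinear_on_def)
  note cV = basis_comb_in[OF V(1,2), of c]
  have "a (basis_comb N \<psi> c) (\<psi> i) = 0" if "i < N" for i
    using form_mat_mult_vec[OF V c(1) that] c(3) that by simp
  then have "a (basis_comb N \<psi> c) v = 0" if "v \<in> V" for v
    by (rule sesquilinear_on_eq_if_eq_on_basis[OF V z cV cV that])
  then have "basis_comb N \<psi> c = (\<lambda>x. 0)" by (rule inj[OF cV])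
  with basis_comb_eq_zero_iff[OF V(1,2) c(1)] c(2) show False by simp
qed

section \<open>The finite element space\<close>

lemma polynomial_of_degree_le_lincomb:
  assumes "polynomial_of_degree_le k p" "polynomial_of_degree_le k q"
  shows "polynomial_of_degree_le k (\<lambda>x. c * p x + d * q x)"
proof -
  let ?S = "{\<alpha> \<in> Basis \<rightarrow>\<^sub>E {..k}. sum \<alpha> Basis \<le> k}"
  obtain e f where "\<And>x. p x = (\<Sum>\<alpha>\<in>?S. e \<alpha> * complex_of_real (\<Prod>b\<in>Basis. (x \<bullet> b) ^ \<alpha> b))"
    "\<And>x. q x = (\<Sum>\<alpha>\<in>?S. f \<alpha> * complex_of_real (\<Prod>b\<in>Basis. (x \<bullet> b) ^ \<alpha> b))"
    using assms unfolding polynomial_of_degree_le_def by blast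
  then have "\<forall>x. c * p x + d * q x =
      (\<Sum>\<alpha>\<in>?S. (c * e \<alpha> + d * f \<alpha>) * complex_of_real (\<Prod>b\<in>Basis. (x \<bullet> b) ^ \<alpha> b))"
    by (simp add: sum_distrib_left sum.distrib ring_distribs mult.assoc)
  then show ?thesis unfolding polynomial_of_degree_le_def by (intro exI)
qed

lemma polynomial_of_degree_le_const: "polynomial_of_degree_le k (\<lambda>x::'a::euclidean_space. z)"
proof -
  let ?S = "{\<alpha> \<in> (Basis :: 'a set) \<rightarrow>\<^sub>E {..k}. sum \<alpha> Basis \<le> k}"
  \<comment> \<open>The multi-index of the monomial 1; \<open>restrict\<close> places it in the
    extensional function set over \<open>Basis\<close>.\<close>
  let ?o = "restrict (\<lambda>b. 0) (Basis :: 'a set)"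
  have fin: "finite ?S" by (rule finite_subset[of _ "Basis \<rightarrow>\<^sub>E {..k}"]) (auto intro: finite_PiE)
  have "?o \<in> ?S" by auto
  then have "z = (\<Sum>\<alpha>\<in>?S. (if \<alpha> = ?o then z else 0) * complex_of_real (\<Prod>b\<in>Basis. (x \<bullet> b) ^ \<alpha> b))"
    for x :: 'a
    using fin by (subst sum.remove[of _ ?o]) (auto intro!: sum.neutral[symmetric])
  then show ?thesis unfolding polynomial_of_degree_le_def by (intro exI allI)
qed

lemma linear_family_fe_space: "linear_family (fe_space \<Omega> \<T> k)"
  unfolding linear_family_def
proof (intro conjI ballI allI)
  have "(\<lambda>x. 0) \<in> fe_space \<Omega> \<T> k"
    unfolding fe_space_def using polynomial_of_degree_le_const by auto
  then show "fe_space \<Omega> \<T> k \<noteq> {}" by auto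
  fix u v c d assume uv: "u \<in> fe_space \<Omega> \<T> k" "v \<in> fe_space \<Omega> \<T> k"
  have "\<exists>p. polynomial_of_degree_le k p \<and> (\<forall>x\<in>T. c * u x + d * v x = p x)" if T: "T \<in> \<T>" for T
  proof -
    obtain p where p: "polynomial_of_degree_le k p" "\<forall>x\<in>T. u x = p x"
      using uv(1) T by (auto simp: fe_space_def)
    obtain q where q: "polynomial_of_degree_le k q" "\<forall>x\<in>T. v x = q x"
      using uv(2) T by (auto simp: fe_space_def)
    show ?thesis
      by (rule exI[of _ "\<lambda>x. c * p x + d * q x"])
        (simp add: polynomial_of_degree_le_lincomb p q)
  qed
  with uv show "(\<lambda>x. c * u x + d * v x) \<in> fe_space \<Omega> \<T> k"
    by (auto simp: fe_space_def intro!: continuous_intros)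
qed

text \<open>The constant 1 in the extension-by-zero representation. It witnesses that the space is
  nontrivial, which makes 1 an actual eigenvalue.\<close>

lemma indicator_in_fe_space:
  assumes "\<Union>\<T> = closure \<Omega>"
  shows "(\<lambda>x. if x \<in> closure \<Omega> then 1 else 0) \<in> fe_space \<Omega> \<T> k"
proof -
  have "continuous_on (closure \<Omega>) (\<lambda>x. if x \<in> closure \<Omega> then 1 else (0::complex))"
    using continuous_on_const[of "closure \<Omega>" "1::complex"] by (rule continuous_on_eq) auto
  moreover have "\<exists>p. polynomial_of_degree_le k p \<and>
      (\<forall>x\<in>T. (if x \<in> closure \<Omega> then 1 else 0) = p x)" if "T \<in> \<T>" for T
    by (rule exI[of _ "\<lambda>x. 1"]) (use that assms polynomial_of_degree_le_const in auto)
  ultimately show ?thesis by (auto simp: fe_space_def)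
qed

lemma integrable_on_bounded_open:
  fixes f :: "'a::euclidean_space \<Rightarrow> complex"
  assumes "open \<Omega>" "bounded \<Omega>" "continuous_on (closure \<Omega>) f"
  shows "integrable (lebesgue_on \<Omega>) f"
proof -
  have "compact (f ` closure \<Omega>)" using assms by (intro compact_continuous_image) auto
  then obtain B where B: "\<And>x. x \<in> closure \<Omega> \<Longrightarrow> norm (f x) \<le> B"
    using compact_imp_bounded[of "f ` closure \<Omega>"] by (auto simp: bounded_iff)
  have sets: "\<Omega> \<in> sets lebesgue" using assms(1) by auto
  have fin: "emeasure (lebesgue_on \<Omega>) \<Omega> < \<infinity>"
    using bounded_set_imp_lmeasurable[OF assms(2) sets] sets
    by (auto simp: emeasure_restrict_space fmeasurable_def simp del: emeasure_completion)
  show ?thesis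
  proof (rule integrableI_bounded_set[of \<Omega>])
    show "\<Omega> \<in> sets (lebesgue_on \<Omega>)" using sets by (simp add: sets_restrict_space_iff)
    show "f \<in> borel_measurable (lebesgue_on \<Omega>)"
      by (rule continuous_imp_measurable_on_sets_lebesgue)
        (use assms sets closure_subset continuous_on_subset in blast)+
    show "AE x in lebesgue_on \<Omega>. x \<in> \<Omega> \<longrightarrow> norm (f x) \<le> B"
      using B closure_subset by (intro AE_I2) blast
    show "AE x in lebesgue_on \<Omega>. x \<notin> \<Omega> \<longrightarrow> f x = 0"
      by (intro AE_I2) simp
  qed (rule fin)
qed

lemma fe_space_continuous: "u \<in> fe_space \<Omega> \<T> k \<Longrightarrow> continuous_on (closure \<Omega>) u"
  by (simp add: fe_space_def)

lemma integrable_fe_product: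
  assumes "open \<Omega>" "bounded \<Omega>" "u \<in> fe_space \<Omega> \<T> k" "v \<in> fe_space \<Omega> \<T> k"
  shows "integrable (lebesgue_on \<Omega>) (\<lambda>x. u x * cnj (v x))"
  using assms by (intro integrable_on_bounded_open continuous_intros fe_space_continuous)

lemma l2_inner_commute: "l2_inner \<Omega> u v = cnj (l2_inner \<Omega> v u)"
  unfolding l2_inner_def by (simp add: mult.commute flip: Bochner_Integration.integral_cnj)

lemma grad_inner_commute: "grad_inner \<Omega> u v = cnj (grad_inner \<Omega> v u)"
  unfolding grad_inner_def by (simp add: mult.commute flip: Bochner_Integration.integral_cnj)

lemma boundary_inner_commute: "boundary_inner \<Gamma> u v = cnj (boundary_inner \<Gamma> v u)"
  unfolding boundary_inner_def set_lebesgue_integral_def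
  by (simp add: mult.commute flip: Bochner_Integration.integral_cnj)

lemma sesquilinear_on_l2_inner:
  assumes "open \<Omega>" "bounded \<Omega>"
  shows "sesquilinear_on (fe_space \<Omega> \<T> k) (l2_inner \<Omega>)"
proof (rule hermitian_sesquilinear_on[OF l2_inner_commute])
  fix u v w c d assume V: "u \<in> fe_space \<Omega> \<T> k" "v \<in> fe_space \<Omega> \<T> k" "w \<in> fe_space \<Omega> \<T> k"
  have "l2_inner \<Omega> w (\<lambda>x. c * u x + d * v x)
      = (LINT x|lebesgue_on \<Omega>. cnj c * (w x * cnj (u x)) + cnj d * (w x * cnj (v x)))"
    unfolding l2_inner_def by (simp add: algebra_simps)
  also have "\<dots> = cnj c * l2_inner \<Omega> w u + cnj d * l2_inner \<Omega> w v"
    unfolding l2_inner_def using integrable_fe_product[OF assms V(3)] V by simp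
  finally show "l2_inner \<Omega> w (\<lambda>x. c * u x + d * v x) = cnj c * l2_inner \<Omega> w u + cnj d * l2_inner \<Omega> w v" .
qed

lemma integrable_fe_cmod_square:
  assumes "open \<Omega>" "bounded \<Omega>" "u \<in> fe_space \<Omega> \<T> k"
  shows "integrable (lebesgue_on \<Omega>) (\<lambda>x. (cmod (u x))\<^sup>2)"
  using integrable_norm[OF integrable_fe_product[OF assms(1,2,3,3)]]
  by (simp add: norm_mult power2_eq_square)

lemma l2_inner_self: "l2_inner \<Omega> u u = complex_of_real ((l2_norm \<Omega> u)\<^sup>2)"
proof -
  have "0 \<le> (LINT x|lebesgue_on \<Omega>. (cmod (u x))\<^sup>2)" by (rule integral_nonneg_AE) simp
  then show ?thesis
    unfolding l2_inner_def l2_norm_def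
    by (simp flip: complex_norm_square of_real_power)
qed

lemma l2_norm_scale: "l2_norm \<Omega> (\<lambda>x. c * u x) = cmod c * l2_norm \<Omega> u"
  unfolding l2_norm_def by (simp add: norm_mult power_mult_distrib real_sqrt_mult)

lemma l2_norm_nonneg: "0 \<le> l2_norm \<Omega> u"
  unfolding l2_norm_def by (simp add: integral_nonneg_AE)

text \<open>The set of points of \<open>\<Omega>\<close> where \<open>u\<close> is nonzero is open
  and of measure zero, hence empty. Continuity carries the zero value to the closure, and outside
  the closure \<open>u\<close> is 0 by convention.\<close>

lemma l2_norm_eq_zero:
  assumes "open \<Omega>" "bounded \<Omega>" "u \<in> fe_space \<Omega> \<T> k" "l2_norm \<Omega> u = 0"
  shows "u = (\<lambda>x. 0)"
proof -
  have sets: "\<Omega> \<in> sets lebesgue" using assms(1) by auto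
  have "(LINT x|lebesgue_on \<Omega>. (cmod (u x))\<^sup>2) = 0" using assms(4) by (simp add: l2_norm_def)
  then have "AE x in lebesgue_on \<Omega>. (cmod (u x))\<^sup>2 = 0"
    by (subst (asm) integral_nonneg_eq_0_iff_AE[OF integrable_fe_cmod_square[OF assms(1-3)]]) auto
  then have ae: "AE x in lebesgue. x \<notin> {x \<in> \<Omega>. u x \<noteq> 0}"
    using sets by (subst (asm) AE_restrict_space_iff) auto
  have "continuous_on \<Omega> u" by (rule continuous_on_subset[OF fe_space_continuous[OF assms(3)] closure_subset])
  then have "open (\<Omega> \<inter> u -` (- {0}))" using assms(1) by (intro continuous_open_preimage) auto
  moreover have eq: "\<Omega> \<inter> u -` (- {0}) = {x \<in> \<Omega>. u x \<noteq> 0}" by auto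
  ultimately have op: "open {x \<in> \<Omega>. u x \<noteq> 0}" by simp
  have "negligible {x \<in> \<Omega>. u x \<noteq> 0}"
    using ae op AE_iff_null_sets[of "{x \<in> \<Omega>. u x \<noteq> 0}" lebesgue] by (simp add: negligible_iff_null_sets)
  then have "{x \<in> \<Omega>. u x \<noteq> 0} = {}" using op open_not_negligible by blast
  then have "u x = 0" if "x \<in> closure \<Omega>" for x
    using continuous_constant_on_closure[OF fe_space_continuous[OF assms(3)] _ that] by blast
  moreover have "u x = 0" if "x \<notin> closure \<Omega>" for x using assms(3) that by (simp add: fe_space_def)
  ultimately show ?thesis by blast
qed

text \<open>Cauchy-Schwarz on the unit ball, which is all that \<open>dual_norm\<close> calls for:
  the pointwise bound of a product by half the sum of squares is integrated.\<close>

lemma l2_inner_le_one: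
  assumes "open \<Omega>" "bounded \<Omega>" "u \<in> fe_space \<Omega> \<T> k" "v \<in> fe_space \<Omega> \<T> k"
    and "l2_norm \<Omega> u \<le> 1" "l2_norm \<Omega> v \<le> 1"
  shows "cmod (l2_inner \<Omega> u v) \<le> 1"
proof -
  note i = integrable_fe_cmod_square[OF assms(1,2)]
  have "cmod (l2_inner \<Omega> u v) \<le> (LINT x|lebesgue_on \<Omega>. ((cmod (u x))\<^sup>2 + (cmod (v x))\<^sup>2) / 2)"
    unfolding l2_inner_def
  proof (rule order_trans[OF integral_norm_bound integral_mono])
    fix x
    have "0 \<le> (cmod (u x) - cmod (v x))\<^sup>2" by simp
    then show "norm (u x * cnj (v x)) \<le> ((cmod (u x))\<^sup>2 + (cmod (v x))\<^sup>2) / 2"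
      by (simp add: norm_mult power2_eq_square algebra_simps)
  qed (use assms i in \<open>auto intro!: integrable_norm integrable_fe_product\<close>)
  also have "\<dots> = ((l2_norm \<Omega> u)\<^sup>2 + (l2_norm \<Omega> v)\<^sup>2) / 2"
    using i[OF assms(3)] i[OF assms(4)] by (simp add: l2_norm_def integral_nonneg_AE)
  also have "\<dots> \<le> 1"
    using assms(5,6) l2_norm_nonneg[of \<Omega> u] l2_norm_nonneg[of \<Omega> v]
      power_mono[of "l2_norm \<Omega> u" 1 2] power_mono[of "l2_norm \<Omega> v" 1 2] by simp
  finally show ?thesis .
qed

section \<open>Operators into the antidual and the inverse bound\<close>

lemma form_operator_injective:
  assumes "linear_family V" "sesquilinear_on V a" "invertible_operator V (form_operator V a)"
    and "u \<in> V" "\<And>v. v \<in> V \<Longrightarrow> a u v = 0"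
  shows "u = (\<lambda>x. 0)"
proof -
  have "form_operator V a u = form_operator V a (\<lambda>x. 0)"
    unfolding form_operator_def
    using assms(5) sesquilinear_on_zero(1)[OF assms(1,2)] by (intro restrict_ext) simp
  then show ?thesis
    using assms(3,4) linear_family_zero[OF assms(1)]
    unfolding invertible_operator_def bij_betw_def by (auto dest: inj_onD)
qed

text \<open>Bijectivity onto \<open>antidual V\<close> includes that each functional
  \<open>a w\<close> restricted to \<open>V\<close> is antilinear.\<close>

lemma invertible_operator_antilinear:
  assumes "linear_family V" "invertible_operator V (form_operator V a)"
    and "u \<in> V" "v \<in> V" "w \<in> V"
  shows "a w (\<lambda>x. c * u x + d * v x) = cnj c * a w u + cnj d * a w v"
proof -
  have "form_operator V a w \<in> antidual V"
    using assms(2,5) by (auto simp: invertible_operator_def bij_betw_def)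
  then have "form_operator V a w (\<lambda>x. c * u x + d * v x)
      = cnj c * form_operator V a w u + cnj d * form_operator V a w v"
    using assms(3,4) unfolding antidual_def by blast
  moreover have "(\<lambda>x. c * u x + d * v x) \<in> V" by (rule linear_familyD[OF assms(1,3,4)])
  ultimately show ?thesis using assms(3,4) by (simp add: form_operator_def)
qed

text \<open>Turns the operator norm bound into an estimate for a single variational problem: scaling
  the data to norm 1 puts the functional into the dual unit ball over which
  \<open>inverse_norm\<close> takes its supremum.\<close>

lemma l2_norm_solution_le:
  assumes \<Omega>: "open \<Omega>" "bounded \<Omega>" and V: "V = fe_space \<Omega> \<T> k"
    and a: "sesquilinear_on V a" and inv: "invertible_operator V (form_operator V a)"
    and C: "inverse_norm \<Omega> V (form_operator V a) \<le> ennreal C"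
    and t: "t \<in> V" and p: "p \<in> V"
    and eq: "\<And>v. v \<in> V \<Longrightarrow> a t v = z * l2_inner \<Omega> p v"
  shows "l2_norm \<Omega> t \<le> C * (cmod z * l2_norm \<Omega> p)"
proof -
  let ?A = "form_operator V a"
  define r where "r = cmod z * l2_norm \<Omega> p"
  note lin = linear_family_fe_space[of \<Omega> \<T> k, folded V]
  note l2 = sesquilinear_on_l2_inner[OF \<Omega>, of \<T> k, folded V]
  show ?thesis
  \<comment> \<open>No scaling is possible for zero data; there the right-hand side functional is
    zero, so injectivity gives \<open>t = 0\<close>.\<close>
  proof (cases "r = 0")
    case True
    have "z * l2_inner \<Omega> p v = 0" if "v \<in> V" for v
    proof (cases "z = 0")
      case False
      with True have "p = (\<lambda>x. 0)" using l2_norm_eq_zero[OF \<Omega>, of p \<T> k] p V by (simp add: r_def)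
      then show ?thesis using sesquilinear_on_zero(1)[OF lin l2 that] by simp
    qed simp
    with eq form_operator_injective[OF lin a inv t] have "t = (\<lambda>x. 0)" by auto
    then have "l2_norm \<Omega> t = 0" by (simp add: l2_norm_def)
    with True show ?thesis by (auto simp: r_def)
  next
    case False
    then have r: "0 < r" using l2_norm_nonneg[of \<Omega> p] by (simp add: r_def order_less_le)
    let ?s = "complex_of_real (1 / r)"
    define w where "w = (\<lambda>x. ?s * t x)"
    define q where "q = (\<lambda>x. (?s * z) * p x)"
    have w: "w \<in> V" and q: "q \<in> V"
      unfolding w_def q_def by (rule linear_family_scale[OF lin t] linear_family_scale[OF lin p])+
    have wq: "a w v = l2_inner \<Omega> q v" if "v \<in> V" for v
      unfolding w_def q_def sesquilinear_on_scale[OF a t that] sesquilinear_on_scale[OF l2 p that]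
      using eq[OF that] by simp
    have "l2_norm \<Omega> q = 1" using r unfolding q_def l2_norm_scale
      by (simp add: norm_mult norm_divide r_def[symmetric] mult.assoc)
    then have "dual_norm \<Omega> V (?A w) \<le> 1"
      unfolding dual_norm_def
      using l2_inner_le_one[OF \<Omega>, of q \<T> k] q V wq
      by (intro SUP_least) (auto simp: form_operator_def ennreal_le_1)
    moreover have "?A w \<in> antidual V" using inv w by (auto simp: invertible_operator_def bij_betw_def)
    ultimately have "ennreal (l2_norm \<Omega> (the_inv_into V ?A (?A w))) \<le> inverse_norm \<Omega> V ?A"
      unfolding inverse_norm_def by (intro SUP_upper) auto
    also have "the_inv_into V ?A (?A w) = w"
      using inv w by (intro the_inv_into_f_f) (auto simp: invertible_operator_def bij_betw_def)
    finally have *: "ennreal (l2_norm \<Omega> w) \<le> ennreal C" using C by (rule order_trans)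
    \<comment> \<open>\<open>ennreal\<close> sends negative reals to 0, so the bound in
      \<open>ennreal\<close> transfers to the reals only once its left side is known to be positive.
      If \<open>w\<close> were 0, testing with \<open>q\<close> would contradict that
      \<open>q\<close> has norm 1.\<close>
    have "l2_norm \<Omega> w \<noteq> 0"
    proof
      assume "l2_norm \<Omega> w = 0"
      then have "w = (\<lambda>x. 0)" using l2_norm_eq_zero[OF \<Omega>] w V by blast
      then have "l2_inner \<Omega> q q = 0" using wq[OF q] sesquilinear_on_zero(1)[OF lin a q] by simp
      with \<open>l2_norm \<Omega> q = 1\<close> show False by (simp add: l2_inner_self)
    qed
    with * l2_norm_nonneg[of \<Omega> w] have "l2_norm \<Omega> w \<le> C"
      by (metis ennreal_eq_0_iff ennreal_le_iff le_zero_eq linorder_linear order_antisym)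
    then show ?thesis using r unfolding w_def l2_norm_scale r_def[symmetric]
      by (simp add: norm_divide field_simps)
  qed
qed

section \<open>Sesquilinearity of the gradient and boundary forms\<close>

lemma sesquilinear_on_grad_inner:
  assumes "open \<Omega>" "bounded \<Omega>" "\<M> \<noteq> 0" "V = fe_space \<Omega> \<T> k"
    and "invertible_operator V (form_operator V (form_T \<Omega> \<M>))"
  shows "sesquilinear_on V (grad_inner \<Omega>)"
proof (rule hermitian_sesquilinear_on[OF grad_inner_commute])
  fix u v w c d assume uvw: "u \<in> V" "v \<in> V" "w \<in> V"
  have "form_T \<Omega> \<M> w (\<lambda>x. c * u x + d * v x) = cnj c * form_T \<Omega> \<M> w u + cnj d * form_T \<Omega> \<M> w v"
    using invertible_operator_antilinear[OF linear_family_fe_space[of \<Omega> \<T> k, folded assms(4)] assms(5) uvw] .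
  then have "of_real \<M> * grad_inner \<Omega> w (\<lambda>x. c * u x + d * v x)
      = of_real \<M> * (cnj c * grad_inner \<Omega> w u + cnj d * grad_inner \<Omega> w v)"
    using sesquilinear_onD2[OF sesquilinear_on_l2_inner[OF assms(1,2), of \<T> k, folded assms(4)] uvw, of c d]
    by (simp add: form_T_def algebra_simps)
  then show "grad_inner \<Omega> w (\<lambda>x. c * u x + d * v x) = cnj c * grad_inner \<Omega> w u + cnj d * grad_inner \<Omega> w v"
    using assms(3) by simp
qed

lemma sesquilinear_on_boundary_inner:
  assumes "open \<Omega>" "bounded \<Omega>" "0 < \<gamma>" "V = fe_space \<Omega> \<T> k"
    and grad: "sesquilinear_on V (grad_inner \<Omega>)"
    and inv: "invertible_operator V (form_operator V (form_P \<Omega> \<Gamma> \<gamma> \<M> \<Lambda>))"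
  shows "sesquilinear_on V (boundary_inner \<Gamma>)"
proof (rule hermitian_sesquilinear_on[OF boundary_inner_commute])
  fix u v w c d assume uvw: "u \<in> V" "v \<in> V" "w \<in> V"
  let ?f = "\<lambda>x. c * u x + d * v x"
  define y where "y = 1 - \<i> * complex_of_real (\<gamma> * \<Lambda>)"
  define z where "z = y * (\<i> * of_real (sqrt \<gamma>))"
  define e where "e = complex_of_real (\<gamma> * (1 - \<Lambda> / \<M>) - \<Lambda> / \<M>)"
  \<comment> \<open>The real part 1 keeps \<open>y\<close> away from 0 for all real parameters, so
    the factor \<open>z\<close> of the boundary form can be cancelled at the end.\<close>
  have "Re y = 1" by (simp add: y_def)
  then have "z \<noteq> 0" using assms(3) by (auto simp: z_def)
  have P: "form_P \<Omega> \<Gamma> \<gamma> \<M> \<Lambda> a b = y * grad_inner \<Omega> a b - z * boundary_inner \<Gamma> a b - e * l2_inner \<Omega> a b"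
    for a b unfolding form_P_def y_def[symmetric] e_def[symmetric] by (simp add: z_def algebra_simps)
  have "form_P \<Omega> \<Gamma> \<gamma> \<M> \<Lambda> w ?f = cnj c * form_P \<Omega> \<Gamma> \<gamma> \<M> \<Lambda> w u + cnj d * form_P \<Omega> \<Gamma> \<gamma> \<M> \<Lambda> w v"
    using invertible_operator_antilinear[OF linear_family_fe_space[of \<Omega> \<T> k, folded assms(4)] inv uvw] .
  then have "z * boundary_inner \<Gamma> w ?f = z * (cnj c * boundary_inner \<Gamma> w u + cnj d * boundary_inner \<Gamma> w v)"
    using sesquilinear_onD2[OF grad uvw, of c d]
      sesquilinear_onD2[OF sesquilinear_on_l2_inner[OF assms(1,2), of \<T> k, folded assms(4)] uvw, of c d]
    unfolding P by (simp add: algebra_simps)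
  with \<open>z \<noteq> 0\<close> show "boundary_inner \<Gamma> w ?f = cnj c * boundary_inner \<Gamma> w u + cnj d * boundary_inner \<Gamma> w v"
    by simp
qed

section \<open>Identification of the blocks and the eigenvalue estimate\<close>

lemma H_T_eq_form_mat: "H_T \<Omega> \<M> N \<psi> = form_mat (form_T \<Omega> \<M>) N \<psi>"
  by (rule eq_matI) (auto simp: H_T_def form_mat_def form_T_def stiff_mat_def mass_mat_def)

lemma H_P_eq_form_mat: "H_P \<Omega> \<Gamma> \<gamma> \<M> \<Lambda> N \<psi> = form_mat (form_P \<Omega> \<Gamma> \<gamma> \<M> \<Lambda>) N \<psi>"
  by (rule eq_matI) (auto simp: H_P_def form_mat_def form_P_def stiff_mat_\<gamma>_def mass_mat_def)

lemma smult_mass_mat_eq_form_mat: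
  "z \<cdot>\<^sub>m mass_mat \<Omega> N \<psi> = form_mat (\<lambda>u v. z * l2_inner \<Omega> u v) N \<psi>"
  by (rule eq_matI) (auto simp: form_mat_def mass_mat_def)

theorem theorem4p2:
  fixes \<Omega> \<Gamma>_a \<Gamma>_w :: "'a::euclidean_space set"
    and H :: "real set" and \<T> :: "real \<Rightarrow> 'a set set"
    and k N :: nat and \<psi> :: "nat \<Rightarrow> 'a \<Rightarrow> complex"
    and \<gamma> \<M> \<Lambda> h\<^sub>0 C_T C_P h :: real
  assumes dim: "DIM('a) = 2 \<or> DIM('a) = 3"
    and domain: "open \<Omega>" "connected \<Omega>" "bounded \<Omega>" "\<Omega> \<noteq> {}"
    and boundary: "frontier \<Omega> = \<Gamma>_a \<union> \<Gamma>_w"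
    and mesh: "\<forall>h\<in>H. 0 < h \<and> conforming_mesh \<Omega> (\<T> h) \<and> mesh_size (\<T> h) = h"
    and quasi: "quasiuniform H \<T>"
    and degree: "1 \<le> k"
    and params: "1 < \<gamma>" "0 < \<M>" "0 < \<Lambda>" "\<Lambda> \<noteq> \<M>"
    and inv_T: "\<forall>h\<in>H. h \<le> h\<^sub>0 \<longrightarrow>
      (let V = fe_space \<Omega> (\<T> h) k; A = form_operator V (form_T \<Omega> \<M>)
       in invertible_operator V A \<and> inverse_norm \<Omega> V A \<le> ennreal C_T)"
    and inv_P: "\<forall>h\<in>H. h \<le> h\<^sub>0 \<longrightarrow>
      (let V = fe_space \<Omega> (\<T> h) k; A = form_operator V (form_P \<Omega> \<Gamma>_a \<gamma> \<M> \<Lambda>)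
       in invertible_operator V A \<and> inverse_norm \<Omega> V A \<le> ennreal C_P)"
    and h: "h \<in> H" "h \<le> h\<^sub>0"
    and basis: "is_basis (fe_space \<Omega> (\<T> h) k) N \<psi>"
  shows "let A = system_mat \<Omega> \<Gamma>_a \<gamma> \<M> \<Lambda> N \<psi>; B = gauss_seidel_mat \<Omega> \<Gamma>_a \<gamma> \<M> \<Lambda> N \<psi>
    in gen_eigenvalue A B 1 \<and> gen_multiplicity A B 1 = N \<and>
       (\<Sum>\<mu> | gen_eigenvalue A B \<mu> \<and> \<mu> \<noteq> 1. gen_multiplicity A B \<mu>) = N \<and>
       (\<forall>\<mu>. gen_eigenvalue A B \<mu> \<and> \<mu> \<noteq> 1 \<longrightarrow>
          \<mu> \<in> cball 1 (C_T * C_P * (\<gamma> - 1) * \<bar>1 - \<Lambda> / \<M>\<bar>))"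
proof -
  define V where "V = fe_space \<Omega> (\<T> h) k"
  define aT where "aT = form_T \<Omega> \<M>"
  define aP where "aP = form_P \<Omega> \<Gamma>_a \<gamma> \<M> \<Lambda>"
  define z1 where "z1 = \<i> * complex_of_real ((\<gamma> - 1) / \<gamma>)"
  define z2 where "z2 = complex_of_real (\<gamma> * (1 - \<Lambda> / \<M>))"
  define T where "T = form_mat aT N \<psi>"
  define P where "P = form_mat aP N \<psi>"
  define M1 where "M1 = form_mat (\<lambda>u v. z1 * l2_inner \<Omega> u v) N \<psi>"
  define M2 where "M2 = form_mat (\<lambda>u v. z2 * l2_inner \<Omega> u v) N \<psi>"
  define A where "A = system_mat \<Omega> \<Gamma>_a \<gamma> \<M> \<Lambda> N \<psi>"
  define B where "B = gauss_seidel_mat \<Omega> \<Gamma>_a \<gamma> \<M> \<Lambda> N \<psi>"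
  have A: "A = four_block_mat T M1 M2 P" and B: "B = four_block_mat T (0\<^sub>m N N) M2 P"
    unfolding A_def B_def system_mat_def gauss_seidel_mat_def T_def P_def M1_def M2_def z1_def z2_def
      aT_def aP_def M_1_def M_2_def H_T_eq_form_mat H_P_eq_form_mat smult_mass_mat_eq_form_mat by simp_all
  \<comment> \<open>\<open>z1\<close> is nonzero by \<open>1 < \<gamma>\<close> and
    \<open>z2\<close> by \<open>\<Lambda> \<noteq> \<M>\<close>; this makes both off-diagonal blocks
    nonsingular.\<close>
  have z12: "z1 \<noteq> 0" "z2 \<noteq> 0" using params by (auto simp: z1_def z2_def)
  have T_inv: "invertible_operator V (form_operator V aT)" "inverse_norm \<Omega> V (form_operator V aT) \<le> ennreal C_T"
    using inv_T h by (auto simp: V_def aT_def Let_def)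
  have P_inv: "invertible_operator V (form_operator V aP)" "inverse_norm \<Omega> V (form_operator V aP) \<le> ennreal C_P"
    using inv_P h by (auto simp: V_def aP_def Let_def)
  have lin: "linear_family V" unfolding V_def by (rule linear_family_fe_space)
  have basis: "is_basis V N \<psi>" using basis by (simp add: V_def)
  have l2: "sesquilinear_on V (l2_inner \<Omega>)"
    unfolding V_def by (rule sesquilinear_on_l2_inner[OF domain(1,3)])
  have grad: "sesquilinear_on V (grad_inner \<Omega>)"
    using sesquilinear_on_grad_inner[OF domain(1,3) _ V_def, of \<M>] T_inv params by (simp add: aT_def)
  have bd: "sesquilinear_on V (boundary_inner \<Gamma>_a)"
    using sesquilinear_on_boundary_inner[OF domain(1,3) _ V_def grad, of \<gamma> \<Gamma>_a \<M> \<Lambda>] P_inv params by (simp add: aP_def)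
  have aT: "sesquilinear_on V aT"
    using sesquilinear_on_lincomb[OF grad l2, of "of_real \<M>" "- \<i>"] by (simp add: aT_def form_T_def[abs_def])
  have aP: "sesquilinear_on V aP"
    using sesquilinear_on_lincomb[OF sesquilinear_on_lincomb[OF grad bd, of 1 "- (\<i> * of_real (sqrt \<gamma>))"] l2,
        of "1 - \<i> * of_real (\<gamma> * \<Lambda>)" "- of_real (\<gamma> * (1 - \<Lambda> / \<M>) - \<Lambda> / \<M>)"]
    unfolding aP_def form_P_def[abs_def] by (simp only: mult_minus_left mult_1_left diff_conv_add_uminus)
  have l2_scaled: "sesquilinear_on V (\<lambda>u v. z * l2_inner \<Omega> u v)" for z
    using sesquilinear_on_lincomb[OF l2 l2, of z 0] by simp
  \<comment> \<open>Testing with \<open>u\<close> itself reduces nonsingularity of a multiple of the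
    mass matrix to definiteness of the norm.\<close>
  have l2_det: "Determinant.det (form_mat (\<lambda>u v. z * l2_inner \<Omega> u v) N \<psi>) \<noteq> 0" if "z \<noteq> 0" for z
  proof (rule det_form_mat_nonzero[OF lin basis l2_scaled])
    fix u assume u: "u \<in> V" and "\<And>v. v \<in> V \<Longrightarrow> z * l2_inner \<Omega> u v = 0"
    then have "l2_inner \<Omega> u u = 0" using that by simp
    then show "u = (\<lambda>x. 0)" using l2_norm_eq_zero[OF domain(1,3) u[unfolded V_def]] by (simp add: l2_inner_self)
  qed
  have det: "Determinant.det T \<noteq> 0" "Determinant.det P \<noteq> 0"
    unfolding T_def P_def
    using det_form_mat_nonzero[OF lin basis aT] form_operator_injective[OF lin aT T_inv(1)]
      det_form_mat_nonzero[OF lin basis aP] form_operator_injective[OF lin aP P_inv(1)] by blast+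
  have car: "T \<in> carrier_mat N N" "M1 \<in> carrier_mat N N" "M2 \<in> carrier_mat N N" "P \<in> carrier_mat N N"
    by (simp_all add: T_def M1_def M2_def P_def)
  \<comment> \<open>With an empty basis every element of \<open>V\<close> would be 0, but the
    constant 1 on the nonempty closure is not.\<close>
  have "N \<noteq> 0"
  proof
    assume "N = 0"
    have "(\<lambda>x. if x \<in> closure \<Omega> then 1 else 0) \<in> V"
      unfolding V_def using mesh h by (intro indicator_in_fe_space) (auto simp: conforming_mesh_def)
    then have "(\<lambda>x. if x \<in> closure \<Omega> then 1 else (0::complex)) = (\<lambda>x. 0)"
      using basis \<open>N = 0\<close> by (auto simp: is_basis_def)
    with domain(4) show False by (metis closure_eq_empty ex_in_conv zero_neq_one)
  qed
  have mult: "gen_multiplicity A B 1 = N"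
    "(\<Sum>\<mu> | gen_eigenvalue A B \<mu> \<and> \<mu> \<noteq> 1. gen_multiplicity A B \<mu>) = N"
    using block_gauss_seidel_spectrum[OF car det(1) l2_det[OF z12(1), folded M1_def]
        l2_det[OF z12(2), folded M2_def] det(2) A B] by auto
  have one: "gen_eigenvalue A B 1"
  proof -
    have "poly (gen_char_poly A B) 1 = 0"
      using mult(1) \<open>N \<noteq> 0\<close> order_0I[of "gen_char_poly A B" 1] by (auto simp: gen_multiplicity_def)
    then show ?thesis
      using gen_eigenvalue_iff_root[of A "N + N" B] car by (simp add: A B)
  qed
  have ball: "\<mu> \<in> cball 1 (C_T * C_P * (\<gamma> - 1) * \<bar>1 - \<Lambda> / \<M>\<bar>)"
    if ev: "gen_eigenvalue A B \<mu>" and ne: "\<mu> \<noteq> 1" for \<mu>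
  proof -
    obtain x y where xy: "x \<in> carrier_vec N" "y \<in> carrier_vec N" "x \<noteq> 0\<^sub>v N \<or> y \<noteq> 0\<^sub>v N"
      and eT: "\<And>i. i < N \<Longrightarrow> (\<mu> - 1) * (T *\<^sub>v x) $ i = (M1 *\<^sub>v y) $ i"
      and eP: "\<And>i. i < N \<Longrightarrow> (P *\<^sub>v y) $ i = - (M2 *\<^sub>v x) $ i"
      using block_gauss_seidel_eigenvector[OF A B car ev ne] by blast
    define t where "t = basis_comb N \<psi> x"
    define p where "p = basis_comb N \<psi> y"
    have t: "t \<in> V" and p: "p \<in> V" unfolding t_def p_def by (rule basis_comb_in[OF lin basis])+
    note mv = form_mat_mult_vec[OF lin basis]
    \<comment> \<open>The first block row as a variational problem for \<open>t\<close> with data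
      \<open>p\<close>; dividing by \<open>\<mu> - 1\<close> puts the eigenvalue into the data,
      where the bound by \<open>C_T\<close> sees it.\<close>
    have "aT t v = (z1 / (\<mu> - 1)) * l2_inner \<Omega> p v" if "v \<in> V" for v
    proof (rule sesquilinear_on_eq_if_eq_on_basis[OF lin basis aT l2_scaled t p that])
      fix i assume i: "i < N"
      have "(\<mu> - 1) * aT t (\<psi> i) = z1 * l2_inner \<Omega> p (\<psi> i)"
        using eT[OF i] mv[OF aT xy(1) i] mv[OF l2_scaled xy(2) i, of z1]
        by (simp add: T_def M1_def t_def p_def del: index_mult_mat_vec)
      then show "aT t (\<psi> i) = (z1 / (\<mu> - 1)) * l2_inner \<Omega> p (\<psi> i)" using ne by (simp add: field_simps)
    qed
    from l2_norm_solution_le[OF domain(1,3) V_def aT T_inv t p this]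
    have bT: "l2_norm \<Omega> t \<le> C_T * (cmod (z1 / (\<mu> - 1)) * l2_norm \<Omega> p)" .
    have "aP p v = (- z2) * l2_inner \<Omega> t v" if "v \<in> V" for v
    proof (rule sesquilinear_on_eq_if_eq_on_basis[OF lin basis aP l2_scaled p t that])
      fix i assume i: "i < N"
      show "aP p (\<psi> i) = (- z2) * l2_inner \<Omega> t (\<psi> i)"
        using eP[OF i] mv[OF aP xy(2) i] mv[OF l2_scaled xy(1) i, of z2]
        by (simp add: P_def M2_def t_def p_def del: index_mult_mat_vec)
    qed
    from l2_norm_solution_le[OF domain(1,3) V_def aP P_inv p t this]
    have bP: "l2_norm \<Omega> p \<le> C_P * (cmod z2 * l2_norm \<Omega> t)" by simp
    have zero: "u = (\<lambda>x. 0)" if "u \<in> V" "l2_norm \<Omega> u = 0" for u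
      using l2_norm_eq_zero[OF domain(1,3)] that by (simp add: V_def)
    \<comment> \<open>If \<open>t\<close> vanished, \<open>bP\<close> would force \<open>p\<close>
      to vanish too, against the eigenvector being nonzero. Hence the norm of \<open>t\<close> can
      be cancelled below.\<close>
    have t0: "l2_norm \<Omega> t \<noteq> 0"
    proof
      assume t0: "l2_norm \<Omega> t = 0"
      with bP l2_norm_nonneg[of \<Omega> p] have "l2_norm \<Omega> p = 0" by simp
      with t0 zero t p have "t = (\<lambda>x. 0)" "p = (\<lambda>x. 0)" by blast+
      then show False using xy basis_comb_eq_zero_iff[OF lin basis] by (simp add: t_def p_def)
    qed
    then have tpos: "0 < l2_norm \<Omega> t" using l2_norm_nonneg[of \<Omega> t] by simp
    \<comment> \<open>The sign comes from \<open>bT\<close> with its positive left side; it allows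
      \<open>bP\<close> to be inserted into \<open>bT\<close> by monotonicity.\<close>
    have "0 \<le> C_T"
    proof (rule ccontr)
      assume "\<not> 0 \<le> C_T"
      then have "C_T * (cmod (z1 / (\<mu> - 1)) * l2_norm \<Omega> p) \<le> 0"
        by (intro mult_nonpos_nonneg) (auto simp: l2_norm_nonneg)
      with bT tpos show False by simp
    qed
    have "l2_norm \<Omega> t \<le> C_T * (cmod (z1 / (\<mu> - 1)) * (C_P * (cmod z2 * l2_norm \<Omega> t)))"
      by (rule order_trans[OF bT]) (intro mult_left_mono bP \<open>0 \<le> C_T\<close> norm_ge_zero)
    also have "\<dots> = (C_T * C_P * (cmod z1 * cmod z2) / cmod (\<mu> - 1)) * l2_norm \<Omega> t"
      by (simp add: norm_divide)
    finally have "1 * l2_norm \<Omega> t \<le> (C_T * C_P * (cmod z1 * cmod z2) / cmod (\<mu> - 1)) * l2_norm \<Omega> t"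
      by simp
    then have "1 \<le> C_T * C_P * (cmod z1 * cmod z2) / cmod (\<mu> - 1)"
      using tpos by (rule mult_right_le_imp_le)
    then have "cmod (\<mu> - 1) \<le> C_T * C_P * (cmod z1 * cmod z2)" using ne by (simp add: le_divide_eq)
    \<comment> \<open>The denominator \<open>\<gamma>\<close> of \<open>z1\<close> cancels against
      the factor \<open>\<gamma>\<close> of \<open>z2\<close>, which leaves the radius
      claimed.\<close>
    also have "cmod z1 * cmod z2 = (\<gamma> - 1) * \<bar>1 - \<Lambda> / \<M>\<bar>"
      using params(1) unfolding z1_def z2_def norm_mult norm_of_real by (simp add: abs_mult)
    finally show ?thesis by (simp add: dist_norm norm_minus_commute mult.assoc)
  qed
  show ?thesis
    using one mult ball unfolding A_def B_def Let_def by blast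
qed

end
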